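(* Suppose that $\{\Xi_t\}_{t\ge0}$ is the solution operator of $$\frac{d\mathbf{z}}{dt}=J^{-1}\nabla\tilde{\mathcal{H}}(\mathbf{z})$$ for a $2N\times2N$ real matrix $J$ which is antisymmetric and invertible and a $C^2$ function $\tilde{\mathcal{H}}:\mathbb{R}^{2N}\to\mathbb{R}$ such that these dynamics are uniquely and globally defined. Then: (i) For every $t\ge0$, $\Xi_t$ is symplectic with respect to $J$. (ii) Suppose there is a linear involution $R:\mathbb{R}^{2N}\to\mathbb{R}^{2N}$ such that $$RJ^{-1}R^*=-J^{-1}\qquad\text{and}\qquad\tilde{\mathcal{H}}(R\mathbf{z})=\tilde{\mathcal{H}}(\mathbf{z})\ \text{ for every }\mathbf{z}\in\mathbb{R}^{2N}.$$ Then, for every $t\ge0$, $\Xi_t$ is reversible with respect to $R$. (iii) In particular, if $$J=\begin{pmatrix} 0 & -A \\ A^* & 0 \end{pmatrix}$$ for an invertible $N\times N$ matrix $A$, and $\tilde{\mathcal{H}}(\mathbf{q},\mathbf{v})=\tilde{\mathcal{H}}(\mathbf{q},-\mathbf{v})$ for all $(\mathbf{q},\mathbf{v})\in\mathbb{R}^{2N}$, then for every $t\ge0$, $\Xi_t$ is reversible with respect to the momentum-flip involution $R(\mathbf{q},\mathbf{v})=(\mathbf{q},-\mathbf{v})$.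
   Context: $\Xi_t(\mathbf{z}_0)$ is the value at time $t$ of the solution starting at $\mathbf{z}_0$ at time $0$. $A^*$ is the (conjugate) transpose. A $C^1$ map $\hat S:\mathbb{R}^{2N}\to\mathbb{R}^{2N}$ is symplectic with respect to an invertible matrix $J$ if $(\nabla\hat S(\mathbf{z}))^*J\,\nabla\hat S(\mathbf{z})=J$ for every $\mathbf{z}$. It is reversible with respect to a linear invertible map $R$ if $\hat S$ is invertible and $R\circ\hat S=\hat S^{-1}\circ R$. A linear involution is a linear map $R$ with $R\circ R=I$. *)

theory Defs
  imports "HOL-Analysis.Analysis"
begin

(* The phase space of dimension 2N is real ^ ('n + 'n) with N = CARD('n); the Inl coordinates
   are the positions q and the Inr coordinates are the velocities v. *)

definition phase_point :: "real ^ 'n \<Rightarrow> real ^ 'n \<Rightarrow> real ^ ('n::finite + 'n)"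
  where "phase_point q v = (\<chi> i. case i of Inl a \<Rightarrow> q $ a | Inr a \<Rightarrow> v $ a)"

definition position :: "real ^ ('n::finite + 'n) \<Rightarrow> real ^ 'n"
  where "position z = (\<chi> a. z $ Inl a)"

definition velocity :: "real ^ ('n::finite + 'n) \<Rightarrow> real ^ 'n"
  where "velocity z = (\<chi> a. z $ Inr a)"

definition momentum_flip :: "real ^ ('n::finite + 'n) \<Rightarrow> real ^ ('n + 'n)"
  where "momentum_flip z = phase_point (position z) (- velocity z)"

definition block_matrix ::
  "real ^ 'n ^ 'n \<Rightarrow> real ^ 'n ^ 'n \<Rightarrow> real ^ 'n ^ 'n \<Rightarrow> real ^ 'n ^ 'n
    \<Rightarrow> real ^ ('n::finite + 'n) ^ ('n + 'n)"
  where "block_matrix A B C D =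
    (\<chi> i j. case i of
        Inl a \<Rightarrow> (case j of Inl b \<Rightarrow> A $ a $ b | Inr b \<Rightarrow> B $ a $ b)
      | Inr a \<Rightarrow> (case j of Inl b \<Rightarrow> C $ a $ b | Inr b \<Rightarrow> D $ a $ b))"

lemma phase_point_position_velocity [simp]: "phase_point (position z) (velocity z) = z"
  by (simp add: phase_point_def position_def velocity_def vec_eq_iff split: sum.split)

lemma momentum_flip_phase_point [simp]: "momentum_flip (phase_point q v) = phase_point q (- v)"
  by (simp add: momentum_flip_def phase_point_def position_def velocity_def vec_eq_iff
      split: sum.split)

lemma linear_momentum_flip: "linear momentum_flip"
  by (rule linearI)
     (auto simp: momentum_flip_def phase_point_def position_def velocity_def vec_eq_iff
      split: sum.split)

lemma momentum_flip_involution: "momentum_flip \<circ> momentum_flip = id"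
  by (simp add: fun_eq_iff momentum_flip_def phase_point_def position_def velocity_def vec_eq_iff
      split: sum.split)

lemma block_matrix_mult_phase_point:
  "block_matrix A B C D *v phase_point q v = phase_point (A *v q + B *v v) (C *v q + D *v v)"
proof -
  have "(\<Sum>j\<in>UNIV. f j) = (\<Sum>a\<in>UNIV. f (Inl a)) + (\<Sum>b\<in>UNIV. f (Inr b))"
    for f :: "'a + 'a \<Rightarrow> real"
    using sum.Plus [of "UNIV :: 'a set" "UNIV :: 'a set" f] by simp
  then show ?thesis
    by (simp add: vec_eq_iff block_matrix_def phase_point_def matrix_vector_mult_def
        split: sum.split)
qed

(* The gradient; meaningful only where the function is differentiable. *)
definition grad :: "('a::real_inner \<Rightarrow> real) \<Rightarrow> 'a \<Rightarrow> 'a"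
  where "grad f x = (THE D. GDERIV f x :> D)"

lemma GDERIV_imp_grad_eq:
  assumes "GDERIV f x :> D"
  shows "grad f x = D"
  unfolding grad_def
proof (rule the_equality)
  fix D' assume "GDERIV f x :> D'"
  then have "(\<lambda>h. inner h D') = (\<lambda>h. inner h D)"
    using assms has_derivative_unique unfolding gderiv_def by blast
  then show "D' = D"
    by (metis vector_eq_ldot)
qed (fact assms)

definition C1_map :: "(real ^ 'm \<Rightarrow> real ^ 'k) \<Rightarrow> bool"
  where "C1_map f \<longleftrightarrow>
    (\<forall>x. f differentiable (at x)) \<and> continuous_on UNIV (\<lambda>x. jacobian f (at x))"

definition C2_function :: "(real ^ 'm \<Rightarrow> real) \<Rightarrow> bool"
  where "C2_function f \<longleftrightarrow> (\<forall>x. f differentiable (at x)) \<and> C1_map (grad f)"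

(* Solutions of dz/dt = f z on [0, \<infinity>), with the one-sided derivative at t = 0; the values of
   z at negative times are irrelevant. *)
definition forward_solution :: "('a::real_normed_vector \<Rightarrow> 'a) \<Rightarrow> 'a \<Rightarrow> (real \<Rightarrow> 'a) \<Rightarrow> bool"
  where "forward_solution f z0 z \<longleftrightarrow>
    z 0 = z0 \<and> (\<forall>t\<ge>0. (z has_vector_derivative f (z t)) (at t within {0..}))"

definition uniquely_globally_defined :: "('a::real_normed_vector \<Rightarrow> 'a) \<Rightarrow> bool"
  where "uniquely_globally_defined f \<longleftrightarrow>
    (\<forall>z0. (\<exists>z. forward_solution f z0 z) \<and>
      (\<forall>z w. forward_solution f z0 z \<and> forward_solution f z0 w \<longrightarrow> (\<forall>t\<ge>0. z t = w t)))"

definition solution_operator ::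
  "('a::real_normed_vector \<Rightarrow> 'a) \<Rightarrow> (real \<Rightarrow> 'a \<Rightarrow> 'a) \<Rightarrow> bool"
  where "solution_operator f \<Xi> \<longleftrightarrow> (\<forall>z0. forward_solution f z0 (\<lambda>t. \<Xi> t z0))"

definition hamiltonian_field ::
  "real ^ 'm ^ 'm \<Rightarrow> (real ^ 'm \<Rightarrow> real) \<Rightarrow> real ^ 'm \<Rightarrow> real ^ 'm"
  where "hamiltonian_field J H z = matrix_inv J *v grad H z"

definition symplectic_wrt :: "real ^ 'm ^ 'm \<Rightarrow> (real ^ 'm \<Rightarrow> real ^ 'm) \<Rightarrow> bool"
  where "symplectic_wrt J S \<longleftrightarrow>
    invertible J \<and> C1_map S \<and>
    (\<forall>z. transpose (jacobian S (at z)) ** J ** jacobian S (at z) = J)"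

definition reversible_wrt :: "('a::real_vector \<Rightarrow> 'a) \<Rightarrow> ('a \<Rightarrow> 'a) \<Rightarrow> bool"
  where "reversible_wrt R S \<longleftrightarrow> linear R \<and> bij R \<and> bij S \<and> R \<circ> S = inv S \<circ> R"

definition linear_involution :: "('a::real_vector \<Rightarrow> 'a) \<Rightarrow> bool"
  where "linear_involution R \<longleftrightarrow> linear R \<and> R \<circ> R = id"

end

(* Only the differentiability of the flow in the initial value needs an idea. By Gronwall, the
   difference u of two solutions that start near z satisfies |u' - A u| <= e |u(0)|, where A(t) is
   the derivative of the field along the solution from z. So linear combinations of such differences
   whose initial values cancel are small at time t, which makes the difference quotients of the flow
   Cauchy and their limit linear. This constructs the derivative without solving the variational
   equation, and as a strict derivative, so that C1 comes for free.
   Symplecticity follows because the form u . J v is conserved by the linearized equation, hence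
   almost conserved by differences of solutions. For reversibility, s |-> R (Xi (t - s) z), prolonged
   beyond s = t by the solution from R z, solves the same equation, so uniqueness yields
   Xi t o R o Xi t = R. *)
theory Submission
  imports Defs
begin

section \<open>Two analytic tools: a vanishing criterion and a Gronwall estimate\<close>

text \<open>The identities below (linearity of the derivative, conservation of a bilinear form,
  symmetry of the Hessian) are all reached as bounds \<open>e * K\<close> for arbitrary
  \<open>e > 0\<close>; this turns such a bound into an equation.\<close>

lemma norm_le_all_imp_0:
  fixes x :: "'a::real_normed_vector"
  assumes "\<And>e. e > 0 \<Longrightarrow> norm x \<le> e * K"
  shows "x = 0"
proof -
  have "norm x \<le> 0"
  proof (rule field_le_epsilon)
    fix e :: real assume "e > 0"
    then have "norm x \<le> (e / (\<bar>K\<bar> + 1)) * K" by (intro assms) auto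
    also have "\<dots> \<le> (e / (\<bar>K\<bar> + 1)) * (\<bar>K\<bar> + 1)"
      using \<open>e > 0\<close> by (intro mult_left_mono) auto
    also have "\<dots> = e" by simp
    finally show "norm x \<le> 0 + e" by simp
  qed
  then show ?thesis by simp
qed

text \<open>The square of the norm is estimated, since the norm itself is not differentiable at 0.
  Adding \<open>c\<^sup>2\<close> absorbs the mixed term \<open>2 * norm (u t) * c\<close>, so that
  the weight with rate \<open>2 * L + 2\<close> makes \<open>\<phi>\<close> decrease. Derivatives
  are required only inside the interval, because a solution has merely a one-sided derivative at
  time 0.\<close>

lemma gronwall_norm:
  fixes u :: "real \<Rightarrow> 'a::real_inner"
  assumes "0 \<le> T" "0 \<le> L" "0 \<le> c"
    and cont: "continuous_on {0..T} u"
    and der: "\<And>t. 0 < t \<Longrightarrow> t < T \<Longrightarrow> (u has_vector_derivative u' t) (at t)"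
    and le: "\<And>t. 0 < t \<Longrightarrow> t < T \<Longrightarrow> norm (u' t) \<le> L * norm (u t) + c"
  shows "norm (u T) \<le> (norm (u 0) + c) * exp ((L + 1) * T)"
proof -
  let ?k = "2 * L + 2"
  define \<phi> where "\<phi> t = (u t \<bullet> u t + c\<^sup>2) * exp (- ?k * t)" for t
  have "\<phi> T \<le> \<phi> 0"
  proof (rule DERIV_nonpos_imp_decreasing_open[where f = \<phi>])
    show "continuous_on {0..T} \<phi>"
      unfolding \<phi>_def by (intro continuous_intros cont)
    fix t assume t: "0 < t" "t < T"
    let ?y = "2 * (u t \<bullet> u' t) * exp (- ?k * t) + (u t \<bullet> u t + c\<^sup>2) * (exp (- ?k * t) * (- ?k))"
    have "((\<lambda>t. u t \<bullet> u t) has_derivative (\<lambda>h. u t \<bullet> (h *\<^sub>R u' t) + (h *\<^sub>R u' t) \<bullet> u t)) (at t)"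
      using der[OF t] unfolding has_vector_derivative_def by (intro derivative_intros)
    then have [derivative_intros]: "((\<lambda>t. u t \<bullet> u t) has_real_derivative 2 * (u t \<bullet> u' t)) (at t)"
      unfolding has_field_derivative_def
      by (rule has_derivative_eq_rhs) (auto simp: fun_eq_iff inner_commute)
    have D: "(\<phi> has_real_derivative ?y) (at t)"
      unfolding \<phi>_def by (auto intro!: derivative_eq_intros)
    have "2 * (u t \<bullet> u' t) \<le> 2 * (norm (u t) * norm (u' t))"
      using norm_cauchy_schwarz by simp
    also have "\<dots> \<le> 2 * (norm (u t) * (L * norm (u t) + c))"
      using le[OF t] by (simp add: mult_left_mono)
    also have "\<dots> = 2 * L * (norm (u t))\<^sup>2 + 2 * norm (u t) * c"
      by (simp add: algebra_simps power2_eq_square)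
    also have "\<dots> \<le> 2 * L * (norm (u t))\<^sup>2 + (norm (u t))\<^sup>2 + c\<^sup>2"
      using sum_squares_bound[of "norm (u t)" c] by simp
    also have "\<dots> \<le> ?k * ((norm (u t))\<^sup>2 + c\<^sup>2)"
    proof -
      have "0 \<le> (norm (u t))\<^sup>2 + (2 * L + 1) * c\<^sup>2" using \<open>0 \<le> L\<close> by simp
      then show ?thesis by (simp add: algebra_simps)
    qed
    finally have "2 * (u t \<bullet> u' t) - ?k * (u t \<bullet> u t + c\<^sup>2) \<le> 0"
      by (simp add: dot_square_norm)
    moreover have "?y = (2 * (u t \<bullet> u' t) - ?k * (u t \<bullet> u t + c\<^sup>2)) * exp (- ?k * t)"
      by (simp add: algebra_simps)
    ultimately have "?y \<le> 0"
      by (simp add: mult_nonpos_nonneg)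
    with D show "\<exists>y. (\<phi> has_real_derivative y) (at t) \<and> y \<le> 0" by blast
  qed (fact assms)
  then have "\<phi> T * exp (?k * T) \<le> \<phi> 0 * exp (?k * T)"
    by (intro mult_right_mono) auto
  moreover have "\<phi> T * exp (?k * T) = (norm (u T))\<^sup>2 + c\<^sup>2"
  proof -
    have "exp (- ?k * T) * exp (?k * T) = 1" by (simp flip: exp_add add: algebra_simps)
    then show ?thesis unfolding \<phi>_def by (simp add: dot_square_norm mult.assoc)
  qed
  moreover have "exp (?k * T) = (exp ((L + 1) * T))\<^sup>2"
    by (simp add: exp_double[symmetric] algebra_simps)
  moreover have "\<phi> 0 = (norm (u 0))\<^sup>2 + c\<^sup>2"
    by (simp add: \<phi>_def dot_square_norm)
  ultimately have "(norm (u T))\<^sup>2 + c\<^sup>2 \<le> ((norm (u 0))\<^sup>2 + c\<^sup>2) * (exp ((L + 1) * T))\<^sup>2"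
    by metis
  \<comment> \<open>The sum of squares is completed to a square, so that both sides are squares and
    the root can be taken.\<close>
  also have "\<dots> \<le> (norm (u 0) + c)\<^sup>2 * (exp ((L + 1) * T))\<^sup>2"
    using \<open>0 \<le> c\<close> by (intro mult_right_mono) (auto simp: power2_sum)
  finally have "(norm (u T))\<^sup>2 \<le> ((norm (u 0) + c) * exp ((L + 1) * T))\<^sup>2"
    by (simp add: power_mult_distrib) (smt (verit) zero_le_power2)
  then show ?thesis
    by (rule power2_le_imp_le) (use \<open>0 \<le> c\<close> in simp)
qed

section \<open>Strict differentiability and its consequences\<close>

text \<open>Unlike in a Frechet derivative, both points move freely near \<open>z\<close>. This
  uniformity is what forces the derivative to depend continuously on \<open>z\<close>.\<close>

definition has_strict_derivative ::
  "('a::real_normed_vector \<Rightarrow> 'b::real_normed_vector) \<Rightarrow> ('a \<Rightarrow> 'b) \<Rightarrow> 'a \<Rightarrow> bool"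
  where "has_strict_derivative F D z \<longleftrightarrow> linear D \<and>
    (\<forall>e>0. \<exists>d>0. \<forall>p\<in>ball z d. \<forall>q\<in>ball z d. norm (F q - F p - D (q - p)) \<le> e * norm (q - p))"

lemma has_strict_derivativeE:
  assumes "has_strict_derivative F D z" "e > 0"
  obtains d where "d > 0"
    "\<And>p q. p \<in> ball z d \<Longrightarrow> q \<in> ball z d \<Longrightarrow> norm (F q - F p - D (q - p)) \<le> e * norm (q - p)"
  using assms unfolding has_strict_derivative_def by blast

lemma eventually_in_ball_Suc:
  fixes z v :: "'a::real_normed_vector"
  assumes "d > 0"
  shows "\<forall>\<^sub>F n in sequentially. z + v /\<^sub>R real (Suc n) \<in> ball z d"
proof -
  have "(\<lambda>n. z + v /\<^sub>R real (Suc n)) \<longlonglongrightarrow> z + 0 *\<^sub>R v"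
    by (intro tendsto_intros LIMSEQ_inverse_real_of_nat)
  then have "(\<lambda>n. z + v /\<^sub>R real (Suc n)) \<longlonglongrightarrow> z" by simp
  then show ?thesis
    using assms by (auto dest!: tendstoD simp: dist_commute)
qed

text \<open>The hypothesis is a Cauchy criterion that does not mention the derivative: difference
  quotients of \<open>F\<close> in the same direction nearly agree. The quotients from
  \<open>z\<close> to \<open>z + v /\<^sub>R real (Suc n)\<close> therefore converge, and their
  limit serves as \<open>D v\<close>. Completeness of the codomain enters here.\<close>

lemma has_strict_derivative_exists:
  fixes F :: "'a::real_normed_vector \<Rightarrow> 'b::banach"
  assumes "\<And>e. e > 0 \<Longrightarrow> \<exists>d>0. \<forall>p\<in>ball z d. \<forall>q\<in>ball z d. \<forall>p'\<in>ball z d. \<forall>q'\<in>ball z d. \<forall>a b.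
    a *\<^sub>R (q - p) = b *\<^sub>R (q' - p') \<longrightarrow>
    norm (a *\<^sub>R (F q - F p) - b *\<^sub>R (F q' - F p')) \<le> e * norm (a *\<^sub>R (q - p))"
  shows "\<exists>D. has_strict_derivative F D z"
proof -
  have comb: "\<exists>d>0. \<forall>p q p' q' a b.
     p \<in> ball z d \<and> q \<in> ball z d \<and> p' \<in> ball z d \<and> q' \<in> ball z d \<and>
    a *\<^sub>R (q - p) = b *\<^sub>R (q' - p') \<longrightarrow>
    norm (a *\<^sub>R (F q - F p) - b *\<^sub>R (F q' - F p')) \<le> e * norm (a *\<^sub>R (q - p))" if "e > 0" for e
    using assms[OF that] by meson
  define X where "X v n = real (Suc n) *\<^sub>R (F (z + v /\<^sub>R real (Suc n)) - F z)" for v n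
  have "Cauchy (X v)" for v
  proof (rule metric_CauchyI)
    fix e :: real assume "e > 0"
    \<comment> \<open>The summand 1 keeps the divisor positive when \<open>v = 0\<close>.\<close>
    define e' where "e' = e / (norm v + 1)"
    have "e' > 0" using \<open>e > 0\<close> by (simp add: e'_def add_nonneg_pos)
    from comb[OF this] obtain d where "d > 0" and
      d: "\<And>p q p' q' a b. p \<in> ball z d \<Longrightarrow> q \<in> ball z d \<Longrightarrow> p' \<in> ball z d \<Longrightarrow> q' \<in> ball z d \<Longrightarrow>
        a *\<^sub>R (q - p) = b *\<^sub>R (q' - p') \<Longrightarrow>
        norm (a *\<^sub>R (F q - F p) - b *\<^sub>R (F q' - F p')) \<le> e' * norm (a *\<^sub>R (q - p))"
      by blast
    obtain N where N: "\<And>n. n \<ge> N \<Longrightarrow> z + v /\<^sub>R real (Suc n) \<in> ball z d"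
      using eventually_in_ball_Suc[OF \<open>d > 0\<close>] unfolding eventually_sequentially by blast
    have "dist (X v m) (X v n) < e" if "m \<ge> N" "n \<ge> N" for m n
    proof -
      have "dist (X v m) (X v n) \<le> e' * norm (real (Suc m) *\<^sub>R (z + v /\<^sub>R real (Suc m) - z))"
        unfolding X_def dist_norm by (rule d) (use N that \<open>d > 0\<close> in \<open>auto simp del: of_nat_Suc\<close>)
      also have "\<dots> = e' * norm v" by (simp del: of_nat_Suc)
      also have "\<dots> < e"
        using \<open>e > 0\<close> by (simp add: e'_def divide_less_eq add_nonneg_pos)
      finally show ?thesis .
    qed
    then show "\<exists>M. \<forall>m\<ge>M. \<forall>n\<ge>M. dist (X v m) (X v n) < e" by blast
  qed
  then have "convergent (X v)" for v by (rule Cauchy_convergent)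
  then obtain D where D: "\<And>v. X v \<longlonglongrightarrow> D v"
    unfolding convergent_def by metis
  \<comment> \<open>The factorisation \<open>q - p = c *\<^sub>R v\<close> stays free because
    \<open>D\<close> is not yet known to be linear; comparing factorisations will prove that it
    is.\<close>
  have strict: "\<exists>d>0. \<forall>p\<in>ball z d. \<forall>q\<in>ball z d. \<forall>c v. q - p = c *\<^sub>R v \<longrightarrow>
      norm (F q - F p - c *\<^sub>R D v) \<le> e * norm (q - p)" if "e > 0" for e
  proof -
    from comb[OF that] obtain d where "d > 0" and
      d: "\<And>p q p' q' a b. p \<in> ball z d \<Longrightarrow> q \<in> ball z d \<Longrightarrow> p' \<in> ball z d \<Longrightarrow> q' \<in> ball z d \<Longrightarrow>
        a *\<^sub>R (q - p) = b *\<^sub>R (q' - p') \<Longrightarrow>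
        norm (a *\<^sub>R (F q - F p) - b *\<^sub>R (F q' - F p')) \<le> e * norm (a *\<^sub>R (q - p))"
      by blast
    have "norm (F q - F p - c *\<^sub>R D v) \<le> e * norm (q - p)"
      if "p \<in> ball z d" "q \<in> ball z d" "q - p = c *\<^sub>R v" for p q c v
    proof (rule tendsto_upperbound)
      show "(\<lambda>n. norm (F q - F p - c *\<^sub>R X v n)) \<longlonglongrightarrow> norm (F q - F p - c *\<^sub>R D v)"
        by (intro tendsto_intros D)
      show "\<forall>\<^sub>F n in sequentially. norm (F q - F p - c *\<^sub>R X v n) \<le> e * norm (q - p)"
        using eventually_in_ball_Suc[OF \<open>d > 0\<close>, of z v]
      proof eventually_elim
        case (elim n)
        then show ?case
          \<comment> \<open>With these factors both scaled differences of arguments equal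
            \<open>c *\<^sub>R v\<close>, and the second scaled difference of values is
            \<open>c *\<^sub>R X v n\<close>.\<close>
          using d[of p q z "z + v /\<^sub>R real (Suc n)" 1 "c * real (Suc n)"] that \<open>d > 0\<close>
          by (simp add: X_def del: of_nat_Suc)
      qed
    qed simp
    with \<open>d > 0\<close> show ?thesis by blast
  qed
  have scale: "D (c *\<^sub>R v) = c *\<^sub>R D v" for c v
  proof -
    have "norm (D (c *\<^sub>R v) - c *\<^sub>R D v) \<le> e * (2 * norm (c *\<^sub>R v))" if "e > 0" for e
    proof -
      obtain d where "d > 0" and d: "\<And>p q c v. p \<in> ball z d \<Longrightarrow> q \<in> ball z d \<Longrightarrow> q - p = c *\<^sub>R v \<Longrightarrow>
          norm (F q - F p - c *\<^sub>R D v) \<le> e * norm (q - p)"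
        using strict[OF \<open>e > 0\<close>] by blast
      obtain n where n: "z + (c *\<^sub>R v) /\<^sub>R real (Suc n) \<in> ball z d"
        using eventually_happens[OF eventually_in_ball_Suc[OF \<open>d > 0\<close>, of z "c *\<^sub>R v"]] by fastforce
      define s where "s = inverse (real (Suc n))"
      have "s > 0" by (simp add: s_def)
      let ?q = "z + s *\<^sub>R (c *\<^sub>R v)"
      have q: "?q \<in> ball z d" "z \<in> ball z d" using n \<open>d > 0\<close> by (auto simp: s_def)
      \<comment> \<open>One difference \<open>?q - z\<close> is factored in two ways, as
        \<open>s\<close> times \<open>c *\<^sub>R v\<close> and as \<open>s * c\<close> times
        \<open>v\<close>.\<close>
      have 1: "norm (F ?q - F z - s *\<^sub>R D (c *\<^sub>R v)) \<le> e * norm (?q - z)"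
        by (rule d) (use q in auto)
      have 2: "norm (F ?q - F z - (s * c) *\<^sub>R D v) \<le> e * norm (?q - z)"
        by (rule d) (use q in auto)
      have "s * norm (D (c *\<^sub>R v) - c *\<^sub>R D v) = norm (s *\<^sub>R D (c *\<^sub>R v) - (s * c) *\<^sub>R D v)"
        using \<open>s > 0\<close> by (simp flip: scaleR_scaleR scaleR_diff_right)
      also have "\<dots> = norm ((F ?q - F z - (s * c) *\<^sub>R D v) - (F ?q - F z - s *\<^sub>R D (c *\<^sub>R v)))"
        by (simp add: algebra_simps)
      also have "\<dots> \<le> e * norm (?q - z) + e * norm (?q - z)"
        using 1 2 by (rule order_trans[OF norm_triangle_ineq4 add_mono, rotated 1])
      also have "\<dots> = s * (e * (2 * norm (c *\<^sub>R v)))" using \<open>s > 0\<close> by (simp add: abs_mult)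
      finally show ?thesis using \<open>s > 0\<close> by simp
    qed
    then have "D (c *\<^sub>R v) - c *\<^sub>R D v = 0" by (rule norm_le_all_imp_0)
    then show ?thesis by simp
  qed
  have add: "D (v + w) = D v + D w" for v w
  proof -
    have "norm (D (v + w) - D v - D w) \<le> e * (norm (v + w) + norm v + norm w)" if "e > 0" for e
    proof -
      obtain d where "d > 0" and d: "\<And>p q c v. p \<in> ball z d \<Longrightarrow> q \<in> ball z d \<Longrightarrow> q - p = c *\<^sub>R v \<Longrightarrow>
          norm (F q - F p - c *\<^sub>R D v) \<le> e * norm (q - p)"
        using strict[OF \<open>e > 0\<close>] by blast
      obtain n where n: "z + w /\<^sub>R real (Suc n) \<in> ball z d"
          "z + (v + w) /\<^sub>R real (Suc n) \<in> ball z d"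
        using eventually_happens[OF eventually_conj[OF eventually_in_ball_Suc[OF \<open>d > 0\<close>, of z w]
              eventually_in_ball_Suc[OF \<open>d > 0\<close>, of z "v + w"]]] by fastforce
      define s where "s = inverse (real (Suc n))"
      have "s > 0" by (simp add: s_def)
      let ?q = "z + s *\<^sub>R (v + w)" and ?p = "z + s *\<^sub>R w"
      have q: "?q \<in> ball z d" "?p \<in> ball z d" "z \<in> ball z d" using n \<open>d > 0\<close> by (auto simp: s_def)
      \<comment> \<open>The three sides of the triangle \<open>z\<close>, \<open>?p\<close>,
        \<open>?q\<close> are estimated; the values of \<open>F\<close> telescope and only those of
        \<open>D\<close> remain.\<close>
      have 1: "norm (F ?q - F z - s *\<^sub>R D (v + w)) \<le> e * norm (?q - z)"
        by (rule d) (use q in auto)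
      have 2: "norm (F ?q - F ?p - s *\<^sub>R D v) \<le> e * norm (?q - ?p)"
        by (rule d) (use q in \<open>auto simp: algebra_simps\<close>)
      have 3: "norm (F ?p - F z - s *\<^sub>R D w) \<le> e * norm (?p - z)"
        by (rule d) (use q in auto)
      have "s * norm (D (v + w) - D v - D w) = norm (s *\<^sub>R D (v + w) - s *\<^sub>R D v - s *\<^sub>R D w)"
        using \<open>s > 0\<close> by (simp flip: scaleR_diff_right)
      also have "\<dots> = norm ((F ?q - F ?p - s *\<^sub>R D v) + (F ?p - F z - s *\<^sub>R D w)
          - (F ?q - F z - s *\<^sub>R D (v + w)))"
        by (simp add: algebra_simps)
      also have "\<dots> \<le> norm (F ?q - F ?p - s *\<^sub>R D v) + norm (F ?p - F z - s *\<^sub>R D w)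
          + norm (F ?q - F z - s *\<^sub>R D (v + w))"
        by (intro order_trans[OF norm_triangle_ineq4] add_right_mono norm_triangle_ineq)
      also have "\<dots> \<le> e * norm (?q - ?p) + e * norm (?p - z) + e * norm (?q - z)"
        using 1 2 3 by linarith
      also have "?q - ?p = s *\<^sub>R v" by (simp add: algebra_simps)
      also have "?p - z = s *\<^sub>R w" by simp
      also have "?q - z = s *\<^sub>R (v + w)" by simp
      finally have "s * norm (D (v + w) - D v - D w) \<le> s * (e * (norm (v + w) + norm v + norm w))"
        using \<open>s > 0\<close> by (simp only: norm_scaleR abs_of_pos distrib_left mult.left_commute[of e s])
      then show ?thesis using \<open>s > 0\<close> by simp
    qed
    then have "D (v + w) - D v - D w = 0" by (rule norm_le_all_imp_0)
    then show ?thesis by (simp add: algebra_simps)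
  qed
  have "linear D" by (rule linearI) (fact add, fact scale)
  moreover have "\<exists>d>0. \<forall>p\<in>ball z d. \<forall>q\<in>ball z d. norm (F q - F p - D (q - p)) \<le> e * norm (q - p)"
    if "e > 0" for e
    using strict[OF that] by (metis scaleR_one)
  ultimately show ?thesis
    unfolding has_strict_derivative_def by blast
qed

lemma has_strict_derivative_imp_has_derivative:
  fixes F :: "'a::euclidean_space \<Rightarrow> 'b::real_normed_vector"
  assumes "has_strict_derivative F D z"
  shows "(F has_derivative D) (at z)"
  unfolding has_derivative_at_alt
proof (intro conjI allI impI)
  show "bounded_linear D"
    using assms by (simp add: has_strict_derivative_def linear_conv_bounded_linear)
  fix e :: real assume "e > 0"
  with assms obtain d where "d > 0" and
    "\<And>p q. p \<in> ball z d \<Longrightarrow> q \<in> ball z d \<Longrightarrow> norm (F q - F p - D (q - p)) \<le> e * norm (q - p)"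
    by (rule has_strict_derivativeE) blast
  from this(1) this(2)[of z] show "\<exists>d>0. \<forall>y. norm (y - z) < d \<longrightarrow> norm (F y - F z - D (y - z)) \<le> e * norm (y - z)"
    by (auto simp: dist_norm norm_minus_commute)
qed

text \<open>Through this limit, bounds on differences of \<open>F\<close> become bounds on
  \<open>D v\<close>.\<close>

lemma has_strict_derivative_imp_LIMSEQ:
  assumes "has_strict_derivative F D z"
  shows "(\<lambda>n. real (Suc n) *\<^sub>R (F (z + v /\<^sub>R real (Suc n)) - F z)) \<longlonglongrightarrow> D v"
proof (rule tendstoI)
  fix e :: real assume "e > 0"
  define e' where "e' = e / (norm v + 1)"
  have v1: "norm v + 1 > 0" by (simp add: add_nonneg_pos)
  have "e' > 0" using \<open>e > 0\<close> v1 by (simp add: e'_def)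
  with assms obtain d where "d > 0" and
    d: "\<And>p q. p \<in> ball z d \<Longrightarrow> q \<in> ball z d \<Longrightarrow> norm (F q - F p - D (q - p)) \<le> e' * norm (q - p)"
    by (rule has_strict_derivativeE) blast
  have lin: "linear D" using assms by (simp add: has_strict_derivative_def)
  show "\<forall>\<^sub>F n in sequentially. dist (real (Suc n) *\<^sub>R (F (z + v /\<^sub>R real (Suc n)) - F z)) (D v) < e"
    using eventually_in_ball_Suc[OF \<open>d > 0\<close>, of z v]
  proof eventually_elim
    case (elim n)
    let ?k = "real (Suc n)"
    have k: "?k > 0" by simp
    have "norm (F (z + v /\<^sub>R ?k) - F z - D (v /\<^sub>R ?k)) \<le> e' * norm (v /\<^sub>R ?k)"
      using d[of z "z + v /\<^sub>R ?k"] elim \<open>d > 0\<close> by simp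
    then have "?k * norm (F (z + v /\<^sub>R ?k) - F z - D (v /\<^sub>R ?k)) \<le> ?k * (e' * norm (v /\<^sub>R ?k))"
      using k by (intro mult_left_mono) auto
    moreover have "?k * (e' * norm (v /\<^sub>R ?k)) = e' * norm v" using k by simp
    moreover have "?k * norm (F (z + v /\<^sub>R ?k) - F z - D (v /\<^sub>R ?k))
        = dist (?k *\<^sub>R (F (z + v /\<^sub>R ?k) - F z)) (D v)"
    proof -
      have "?k * norm (F (z + v /\<^sub>R ?k) - F z - D (v /\<^sub>R ?k))
          = norm (?k *\<^sub>R (F (z + v /\<^sub>R ?k) - F z - D (v /\<^sub>R ?k)))" using k by simp
      also have "?k *\<^sub>R (F (z + v /\<^sub>R ?k) - F z - D (v /\<^sub>R ?k)) = ?k *\<^sub>R (F (z + v /\<^sub>R ?k) - F z) - D v"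
        using k by (simp add: scaleR_diff_right linear_scale[OF lin] del: of_nat_Suc)
      finally show ?thesis by (simp add: dist_norm)
    qed
    moreover have "e' * norm v < e"
      using \<open>e > 0\<close> v1 by (simp add: e'_def field_simps)
    ultimately show ?case by linarith
  qed
qed

text \<open>The estimate around \<open>z\<close> holds for pairs near \<open>y\<close> as well, so
  the difference quotients at \<open>y\<close> lie within \<open>e * norm v\<close> of
  \<open>D v\<close>, and so does their limit. With \<open>D\<close> the derivative at
  \<open>z\<close>, this is continuity of the derivative.\<close>

lemma has_strict_derivative_diff_le:
  assumes "has_strict_derivative F D1 y"
    and "y \<in> ball z d"
    and le: "\<And>p q. p \<in> ball z d \<Longrightarrow> q \<in> ball z d \<Longrightarrow> norm (F q - F p - D (q - p)) \<le> e * norm (q - p)"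
    and "linear D"
  shows "norm (D1 v - D v) \<le> e * norm v"
proof (rule tendsto_upperbound)
  let ?X = "\<lambda>n. real (Suc n) *\<^sub>R (F (y + v /\<^sub>R real (Suc n)) - F y)"
  show "(\<lambda>n. norm (?X n - D v)) \<longlonglongrightarrow> norm (D1 v - D v)"
    by (intro tendsto_intros has_strict_derivative_imp_LIMSEQ assms)
  obtain r where "r > 0" and r: "ball y r \<subseteq> ball z d"
    using assms(2) open_ball open_contains_ball by blast
  show "\<forall>\<^sub>F n in sequentially. norm (?X n - D v) \<le> e * norm v"
    using eventually_in_ball_Suc[OF \<open>r > 0\<close>, of y v]
  proof eventually_elim
    case (elim n)
    let ?k = "real (Suc n)"
    have k: "?k > 0" by simp
    have "norm (F (y + v /\<^sub>R ?k) - F y - D (v /\<^sub>R ?k)) \<le> e * norm (v /\<^sub>R ?k)"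
      using le[of y "y + v /\<^sub>R ?k"] elim r assms(2) by auto
    then have "?k * norm (F (y + v /\<^sub>R ?k) - F y - D (v /\<^sub>R ?k)) \<le> ?k * (e * norm (v /\<^sub>R ?k))"
      using k by (intro mult_left_mono) auto
    moreover have "?k * (e * norm (v /\<^sub>R ?k)) = e * norm v" using k by simp
    moreover have "?k * norm (F (y + v /\<^sub>R ?k) - F y - D (v /\<^sub>R ?k))
        = norm (?k *\<^sub>R (F (y + v /\<^sub>R ?k) - F y - D (v /\<^sub>R ?k)))" using k by simp
    moreover have "?k *\<^sub>R (F (y + v /\<^sub>R ?k) - F y - D (v /\<^sub>R ?k)) = ?X n - D v"
      using k by (simp add: scaleR_diff_right linear_scale[OF \<open>linear D\<close>] del: of_nat_Suc)
    ultimately show ?case by metis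
  qed
qed simp

text \<open>Continuity of \<open>D z v\<close> in \<open>z\<close> for each fixed \<open>v\<close>
  is enough, since the columns of the Jacobian are the images of the finitely many basis
  vectors.\<close>

lemma C1_map_if_has_strict_derivative:
  fixes F :: "real ^ 'm \<Rightarrow> real ^ 'k"
  assumes strict: "\<And>z. has_strict_derivative F (D z) z"
  shows "C1_map F"
proof -
  have der: "(F has_derivative D z) (at z)" for z
    using strict by (rule has_strict_derivative_imp_has_derivative)
  then have jac: "jacobian F (at z) = matrix (D z)" for z
    unfolding jacobian_def by (metis frechet_derivative_at)
  have "continuous_on UNIV (\<lambda>z. D z v)" for v
  proof (rule continuous_on_iff[THEN iffD2], intro ballI allI impI)
    fix z :: "real ^ 'm" and e :: real assume "e > 0"
    have v1: "norm v + 1 > 0" by (simp add: add_nonneg_pos)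
    then have "e / (norm v + 1) > 0" using \<open>e > 0\<close> by simp
    with strict[of z] obtain d where "d > 0" and
      d: "\<And>p q. p \<in> ball z d \<Longrightarrow> q \<in> ball z d \<Longrightarrow>
        norm (F q - F p - D z (q - p)) \<le> e / (norm v + 1) * norm (q - p)"
      by (rule has_strict_derivativeE) blast
    have "dist (D y v) (D z v) < e" if "dist y z < d" for y
    proof -
      have "norm (D y v - D z v) \<le> e / (norm v + 1) * norm v"
        using strict[of y] _ d
        by (rule has_strict_derivative_diff_le)
           (use that strict[of z] in \<open>auto simp: dist_commute has_strict_derivative_def\<close>)
      also have "\<dots> < e" using \<open>e > 0\<close> v1 by (simp add: field_simps)
      finally show ?thesis by (simp add: dist_norm)
    qed
    with \<open>d > 0\<close> show "\<exists>d>0. \<forall>y\<in>UNIV. dist y z < d \<longrightarrow> dist (D y v) (D z v) < e" by blast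
  qed
  then have "continuous_on UNIV (\<lambda>z. matrix (D z))"
    unfolding matrix_def by (intro continuous_on_vec_lambda continuous_on_component) auto
  with der show ?thesis
    unfolding C1_map_def jac by (auto simp: differentiable_def)
qed

section \<open>The flow of a C1 field: dependence on the initial value and conserved bilinear
  forms\<close>

text \<open>The derivative is valued in bounded linear operators, so its continuity refers to the
  operator norm, as the mean value inequality needs.\<close>

locale C1_flow =
  fixes f :: "'a::euclidean_space \<Rightarrow> 'a"
    and f' :: "'a \<Rightarrow> 'a \<Rightarrow>\<^sub>L 'a"
    and \<Xi> :: "real \<Rightarrow> 'a \<Rightarrow> 'a"
  assumes has_derivative_field: "\<And>x. (f has_derivative blinfun_apply (f' x)) (at x)"
    and continuous_field_derivative: "continuous_on UNIV f'"
    and flow: "solution_operator f \<Xi>"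
begin

lemma flow_0 [simp]: "\<Xi> 0 z = z"
  using flow by (simp add: solution_operator_def forward_solution_def)

lemma flow_has_vector_derivative:
  assumes "t > 0"
  shows "((\<lambda>t. \<Xi> t z) has_vector_derivative f (\<Xi> t z)) (at t)"
proof -
  have "((\<lambda>t. \<Xi> t z) has_vector_derivative f (\<Xi> t z)) (at t within {0..})"
    using flow assms by (simp add: solution_operator_def forward_solution_def)
  moreover have "at t within {0..} = at t"
    using assms by (intro at_within_interior) simp
  ultimately show ?thesis by simp
qed

lemma continuous_on_flow: "continuous_on {0..T} (\<lambda>t. \<Xi> t z)"
proof -
  have "continuous_on {0..} (\<lambda>t. \<Xi> t z)"
    using flow unfolding solution_operator_def forward_solution_def
    by (intro continuous_on_vector_derivative) auto
  then show ?thesis by (rule continuous_on_subset) auto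
qed

lemma compact_orbit: "compact ((\<lambda>t. \<Xi> t z) ` {0..T})"
  by (intro compact_continuous_image continuous_on_flow) auto

text \<open>Uniform continuity of \<open>f'\<close> near \<open>K\<close> gives one radius for all
  \<open>x\<close>. The mean value inequality is then applied to \<open>f\<close> minus its linear
  part at \<open>x\<close>, whose derivative has norm at most \<open>e\<close> on the ball.\<close>

lemma field_linearization_on_compact:
  assumes "compact K" "e > 0"
  obtains d where "d > 0"
    "\<And>x y z. x \<in> K \<Longrightarrow> y \<in> ball x d \<Longrightarrow> z \<in> ball x d \<Longrightarrow>
      norm (f z - f y - f' x (z - y)) \<le> e * norm (z - y)"
proof -
  obtain M where M: "\<And>x. x \<in> K \<Longrightarrow> norm x \<le> M"
    using \<open>compact K\<close> compact_imp_bounded bounded_iff by metis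
  \<comment> \<open>The enlarged radius leaves room for balls of radius at most 1 around points of
    \<open>K\<close>.\<close>
  have "uniformly_continuous_on (cball 0 (M + 1)) f'"
    by (intro compact_uniformly_continuous continuous_on_subset[OF continuous_field_derivative]) auto
  then obtain d0 where "d0 > 0" and
    d0: "\<And>x y. x \<in> cball 0 (M + 1) \<Longrightarrow> y \<in> cball 0 (M + 1) \<Longrightarrow> dist y x < d0 \<Longrightarrow> dist (f' y) (f' x) < e"
    using \<open>e > 0\<close> unfolding uniformly_continuous_on_def by meson
  define d where "d = min d0 1"
  have "norm (f z - f y - f' x (z - y)) \<le> e * norm (z - y)"
    if "x \<in> K" "y \<in> ball x d" "z \<in> ball x d" for x y z
  proof -
    have "norm ((f z - f' x z) - (f y - f' x y)) \<le> e * norm (z - y)"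
    proof (rule differentiable_bound)
      show "convex (ball x d)" by (rule convex_ball)
      fix w assume w: "w \<in> ball x d"
      have "(f has_derivative blinfun_apply (f' w)) (at w within ball x d)"
        using has_derivative_field by (rule has_derivative_at_withinI)
      moreover have "(blinfun_apply (f' x) has_derivative blinfun_apply (f' x)) (at w within ball x d)"
        by (intro bounded_linear_imp_has_derivative blinfun.bounded_linear_right)
      ultimately show "((\<lambda>w. f w - f' x w) has_derivative blinfun_apply (f' w - f' x)) (at w within ball x d)"
        by (auto intro!: derivative_eq_intros simp: blinfun.bilinear_simps)
      have "norm w \<le> norm x + dist w x"
        by (metis dist_norm add.commute norm_triangle_sub)
      then have "dist (f' w) (f' x) < e"
        using M[OF \<open>x \<in> K\<close>] w by (intro d0) (auto simp: d_def dist_commute)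
      then show "onorm (blinfun_apply (f' w - f' x)) \<le> e"
        by (simp add: dist_norm norm_blinfun.rep_eq)
    qed (use that in auto)
    then show ?thesis by (simp add: blinfun.diff_right algebra_simps)
  qed
  moreover have "d > 0" using \<open>d0 > 0\<close> by (simp add: d_def)
  ultimately show thesis using that by blast
qed

lemma field_derivative_bound:
  obtains L where "L \<ge> 0" "\<And>t. 0 \<le> t \<Longrightarrow> t \<le> T \<Longrightarrow> norm (f' (\<Xi> t z)) \<le> L"
proof -
  have "compact (f' ` (\<lambda>t. \<Xi> t z) ` {0..T})"
    by (intro compact_continuous_image[OF _ compact_orbit]
        continuous_on_subset[OF continuous_field_derivative]) auto
  then obtain L where "L > 0" "\<And>x. x \<in> f' ` (\<lambda>t. \<Xi> t z) ` {0..T} \<Longrightarrow> norm x \<le> L"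
    using compact_imp_bounded bounded_pos by metis
  then show thesis using that[of L] by auto
qed

text \<open>The field is Lipschitz in a tube of radius \<open>r\<close> around the orbit of
  \<open>z\<close>, so Gronwall applies while solutions remain in the tube. Starting closer than
  \<open>r / C\<close>, they cannot leave it: at the first exit time the distance would still be
  below \<open>r\<close>.\<close>

lemma flow_lipschitz:
  obtains d C where "d > 0" "C > 0"
    "\<And>x y t. x \<in> ball z d \<Longrightarrow> y \<in> ball z d \<Longrightarrow> 0 \<le> t \<Longrightarrow> t \<le> T \<Longrightarrow>
      norm (\<Xi> t y - \<Xi> t x) \<le> C * norm (y - x)"
proof -
  obtain r where "r > 0" and r: "\<And>x y w. x \<in> (\<lambda>t. \<Xi> t z) ` {0..T} \<Longrightarrow> y \<in> ball x r \<Longrightarrow> w \<in> ball x r \<Longrightarrow>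
      norm (f w - f y - f' x (w - y)) \<le> 1 * norm (w - y)"
    using field_linearization_on_compact[OF compact_orbit[of z T], of 1] by auto
  obtain L where "L \<ge> 0" and L: "\<And>t. 0 \<le> t \<Longrightarrow> t \<le> T \<Longrightarrow> norm (f' (\<Xi> t z)) \<le> L"
    using field_derivative_bound by blast
  have lip: "norm (f w - f y) \<le> (L + 1) * norm (w - y)"
    if "0 \<le> t" "t \<le> T" "y \<in> ball (\<Xi> t z) r" "w \<in> ball (\<Xi> t z) r" for t w y
  proof -
    have "norm (f w - f y - f' (\<Xi> t z) (w - y)) \<le> norm (w - y)"
      using r[of "\<Xi> t z" y w] that by auto
    moreover have "norm (f' (\<Xi> t z) (w - y)) \<le> L * norm (w - y)"
      using norm_blinfun L[OF that(1,2)] by (rule order_trans[OF _ mult_right_mono]) auto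
    moreover have "norm (f w - f y) \<le> norm (f w - f y - f' (\<Xi> t z) (w - y)) + norm (f' (\<Xi> t z) (w - y))"
      by (metis add.commute norm_triangle_sub)
    ultimately show ?thesis by (simp add: algebra_simps)
  qed
  \<comment> \<open>The rate is the Lipschitz constant \<open>L + 1\<close> plus the 1 from the
    Gronwall estimate; the absolute value covers negative \<open>T\<close>.\<close>
  define C where "C = exp ((L + 2) * \<bar>T\<bar>)"
  have C: "norm (\<Xi> t y - \<Xi> t x) \<le> C * norm (y - x)"
    if "0 \<le> t" "t \<le> T"
      \<comment> \<open>Only times strictly before \<open>t\<close> are constrained, so the bound is
        available at the exit time itself.\<close>
      and near: "\<And>s. 0 < s \<Longrightarrow> s < t \<Longrightarrow> \<Xi> s x \<in> ball (\<Xi> s z) r \<and> \<Xi> s y \<in> ball (\<Xi> s z) r" for t x y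
  proof -
    have "norm (\<Xi> t y - \<Xi> t x) \<le> (norm (\<Xi> 0 y - \<Xi> 0 x) + 0) * exp ((L + 1 + 1) * t)"
    proof (rule gronwall_norm)
      show "continuous_on {0..t} (\<lambda>t. \<Xi> t y - \<Xi> t x)"
        by (intro continuous_intros continuous_on_flow)
      fix s assume s: "0 < s" "s < t"
      show "((\<lambda>t. \<Xi> t y - \<Xi> t x) has_vector_derivative f (\<Xi> s y) - f (\<Xi> s x)) (at s)"
        using s by (intro derivative_intros flow_has_vector_derivative) auto
      show "norm (f (\<Xi> s y) - f (\<Xi> s x)) \<le> (L + 1) * norm (\<Xi> s y - \<Xi> s x) + 0"
        using lip[of s "\<Xi> s x" "\<Xi> s y"] near[OF s] s that by simp
    qed (use that \<open>L \<ge> 0\<close> in auto)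
    also have "\<dots> \<le> (norm (\<Xi> 0 y - \<Xi> 0 x) + 0) * C"
      unfolding C_def using that \<open>L \<ge> 0\<close> by (intro mult_left_mono) (auto intro!: mult_mono)
    finally show ?thesis by (simp add: mult.commute)
  qed
  have "C > 0" by (simp add: C_def)
  define d where "d = r / C"
  have "d > 0" using \<open>r > 0\<close> \<open>C > 0\<close> by (simp add: d_def)
  have near: "\<Xi> t x \<in> ball (\<Xi> t z) r" if x: "x \<in> ball z d" and "0 \<le> t" "t \<le> T" for t x
  proof (rule ccontr)
    assume far: "\<Xi> t x \<notin> ball (\<Xi> t z) r"
    \<comment> \<open>The set of times outside the tube is compact, so it has a least element
      \<open>\<tau>\<close>, the first exit time.\<close>
    define S where "S = {0..t} \<inter> (\<lambda>s. norm (\<Xi> s x - \<Xi> s z)) -` {r..}"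
    have "closed S" unfolding S_def
      by (rule continuous_closed_preimage) (intro continuous_intros continuous_on_flow closed_atLeast)+
    moreover have "bounded S" unfolding S_def by (rule bounded_subset[of "{0..t}"]) auto
    ultimately have "compact S" by (simp add: compact_eq_bounded_closed)
    moreover have "t \<in> S" using far that by (simp add: S_def dist_norm norm_minus_commute)
    ultimately obtain \<tau> where \<tau>: "\<tau> \<in> S" "\<And>s. s \<in> S \<Longrightarrow> \<tau> \<le> s"
      using compact_attains_inf[of S] by blast
    have "norm (\<Xi> \<tau> x - \<Xi> \<tau> z) \<le> C * norm (x - z)"
    proof (rule C)
      fix s assume "0 < s" "s < \<tau>"
      then have "s \<notin> S" using \<tau>(2) by force
      then show "\<Xi> s z \<in> ball (\<Xi> s z) r \<and> \<Xi> s x \<in> ball (\<Xi> s z) r"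
        using \<tau>(1) \<open>0 < s\<close> \<open>s < \<tau>\<close> \<open>r > 0\<close> by (auto simp: S_def dist_norm norm_minus_commute)
    qed (use \<tau>(1) that in \<open>auto simp: S_def\<close>)
    also have "\<dots> < r"
      using x \<open>C > 0\<close> by (simp add: d_def dist_norm norm_minus_commute field_simps)
    finally show False using \<tau>(1) by (simp add: S_def)
  qed
  show thesis
    by (rule that[OF \<open>d > 0\<close> \<open>C > 0\<close>], rule C) (auto intro!: near[unfolded mem_ball])
qed

text \<open>The linearization error of the field along the flow is measured by the distance of the
  initial values; the Lipschitz bound converts the current distance into it.\<close>

lemma flow_linearization:
  assumes "e > 0"
  obtains d where "d > 0"
    "\<And>x y t. x \<in> ball z d \<Longrightarrow> y \<in> ball z d \<Longrightarrow> 0 \<le> t \<Longrightarrow> t \<le> T \<Longrightarrow>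
      norm (f (\<Xi> t y) - f (\<Xi> t x) - f' (\<Xi> t z) (\<Xi> t y - \<Xi> t x)) \<le> e * norm (y - x)"
proof -
  obtain d0 C where "d0 > 0" "C > 0"
    and C: "\<And>x y t. x \<in> ball z d0 \<Longrightarrow> y \<in> ball z d0 \<Longrightarrow> 0 \<le> t \<Longrightarrow> t \<le> T \<Longrightarrow>
      norm (\<Xi> t y - \<Xi> t x) \<le> C * norm (y - x)"
    using flow_lipschitz by blast
  have "e / C > 0" using \<open>e > 0\<close> \<open>C > 0\<close> by simp
  then obtain r where "r > 0" and r: "\<And>x y w. x \<in> (\<lambda>t. \<Xi> t z) ` {0..T} \<Longrightarrow> y \<in> ball x r \<Longrightarrow> w \<in> ball x r \<Longrightarrow>
      norm (f w - f y - f' x (w - y)) \<le> e / C * norm (w - y)"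
    using field_linearization_on_compact[OF compact_orbit[of z T]] by blast
  define d where "d = min d0 (r / C)"
  have "d > 0" using \<open>d0 > 0\<close> \<open>r > 0\<close> \<open>C > 0\<close> by (simp add: d_def)
  have near: "\<Xi> t x \<in> ball (\<Xi> t z) r" if "x \<in> ball z d" "0 \<le> t" "t \<le> T" for t x
  proof -
    have "dist (\<Xi> t z) (\<Xi> t x) \<le> C * dist z x"
      using C[of x z t] that \<open>d0 > 0\<close> by (simp add: d_def dist_norm)
    also have "\<dots> < r" using that \<open>C > 0\<close> by (simp add: d_def field_simps)
    finally show ?thesis by simp
  qed
  have "norm (f (\<Xi> t y) - f (\<Xi> t x) - f' (\<Xi> t z) (\<Xi> t y - \<Xi> t x)) \<le> e * norm (y - x)"
    if xy: "x \<in> ball z d" "y \<in> ball z d" and t: "0 \<le> t" "t \<le> T" for x y t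
  proof -
    have "norm (f (\<Xi> t y) - f (\<Xi> t x) - f' (\<Xi> t z) (\<Xi> t y - \<Xi> t x)) \<le> e / C * norm (\<Xi> t y - \<Xi> t x)"
      using t by (intro r near xy) auto
    also have "\<dots> \<le> e / C * (C * norm (y - x))"
      using xy t \<open>e / C > 0\<close> by (intro mult_left_mono C) (auto simp: d_def)
    also have "\<dots> = e * norm (y - x)" using \<open>C > 0\<close> by simp
    finally show ?thesis .
  qed
  with \<open>d > 0\<close> show thesis using that by blast
qed

text \<open>The Cauchy criterion is verified for \<open>u\<close>, the difference of the two scaled
  differences of solutions. It solves the linearized equation up to a small error and starts at 0,
  so Gronwall keeps it small.\<close>

lemma flow_has_strict_derivative:
  assumes "T \<ge> 0"
  shows "\<exists>D. has_strict_derivative (\<Xi> T) D z"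
proof (rule has_strict_derivative_exists)
  fix e :: real assume "e > 0"
  obtain L where "L \<ge> 0" and L: "\<And>t. 0 \<le> t \<Longrightarrow> t \<le> T \<Longrightarrow> norm (f' (\<Xi> t z)) \<le> L"
    using field_derivative_bound by blast
  \<comment> \<open>This is the Gronwall factor. Each of the two error terms gets the tolerance
    \<open>e / (2 * k)\<close>, so that the final bound is exactly \<open>e\<close>.\<close>
  define k where "k = exp ((L + 1) * T)"
  have "k > 0" by (simp add: k_def)
  then have "e / (2 * k) > 0" using \<open>e > 0\<close> by simp
  then obtain d where "d > 0" and
    d: "\<And>x y t. x \<in> ball z d \<Longrightarrow> y \<in> ball z d \<Longrightarrow> 0 \<le> t \<Longrightarrow> t \<le> T \<Longrightarrow>
      norm (f (\<Xi> t y) - f (\<Xi> t x) - f' (\<Xi> t z) (\<Xi> t y - \<Xi> t x)) \<le> e / (2 * k) * norm (y - x)"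
    using flow_linearization by blast
  have "norm (a *\<^sub>R (\<Xi> T q - \<Xi> T p) - b *\<^sub>R (\<Xi> T q' - \<Xi> T p')) \<le> e * norm (a *\<^sub>R (q - p))"
    if pq: "p \<in> ball z d" "q \<in> ball z d" "p' \<in> ball z d" "q' \<in> ball z d"
      and ab: "a *\<^sub>R (q - p) = b *\<^sub>R (q' - p')" for p q p' q' a b
  proof -
    define u where "u t = a *\<^sub>R (\<Xi> t q - \<Xi> t p) - b *\<^sub>R (\<Xi> t q' - \<Xi> t p')" for t
    define u' where "u' t = a *\<^sub>R (f (\<Xi> t q) - f (\<Xi> t p)) - b *\<^sub>R (f (\<Xi> t q') - f (\<Xi> t p'))" for t
    have "norm (u T) \<le> (norm (u 0) + e / k * norm (a *\<^sub>R (q - p))) * exp ((L + 1) * T)"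
    proof (rule gronwall_norm)
      show "continuous_on {0..T} u"
        unfolding u_def by (intro continuous_intros continuous_on_flow)
      fix t assume t: "0 < t" "t < T"
      have u': "((\<lambda>t. c *\<^sub>R (\<Xi> t y - \<Xi> t x)) has_vector_derivative c *\<^sub>R (f (\<Xi> t y) - f (\<Xi> t x))) (at t)"
        for c x y
        using bounded_linear.has_vector_derivative[OF bounded_linear_scaleR_right
          has_vector_derivative_diff[OF flow_has_vector_derivative flow_has_vector_derivative]] t
        by blast
      then show "(u has_vector_derivative u' t) (at t)"
        unfolding u_def u'_def by (intro has_vector_derivative_diff)
      let ?E = "\<lambda>x y. f (\<Xi> t y) - f (\<Xi> t x) - f' (\<Xi> t z) (\<Xi> t y - \<Xi> t x)"
      have E: "norm (c *\<^sub>R ?E x y) \<le> e / (2 * k) * norm (c *\<^sub>R (y - x))"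
        if "x \<in> ball z d" "y \<in> ball z d" for x y c
      proof -
        have "\<bar>c\<bar> * norm (?E x y) \<le> \<bar>c\<bar> * (e / (2 * k) * norm (y - x))"
          using t by (intro mult_left_mono d that) auto
        then show ?thesis by (simp only: norm_scaleR mult.left_commute[of "e / (2 * k)"])
      qed
      have "u' t = f' (\<Xi> t z) (u t) + a *\<^sub>R ?E p q - b *\<^sub>R ?E p' q'"
        unfolding u_def u'_def by (simp add: blinfun.diff_right blinfun.scaleR_right scaleR_diff_right)
      then have "norm (u' t) \<le> norm (f' (\<Xi> t z) (u t)) + norm (a *\<^sub>R ?E p q) + norm (b *\<^sub>R ?E p' q')"
        by (simp only:) (intro order_trans[OF norm_triangle_ineq4] add_right_mono norm_triangle_ineq)
      also have "\<dots> \<le> L * norm (u t) + e / (2 * k) * norm (a *\<^sub>R (q - p)) + e / (2 * k) * norm (a *\<^sub>R (q - p))"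
      proof (rule add_mono[OF add_mono])
        have "norm (f' (\<Xi> t z) (u t)) \<le> norm (f' (\<Xi> t z)) * norm (u t)" by (rule norm_blinfun)
        also have "\<dots> \<le> L * norm (u t)" using t by (intro mult_right_mono L) auto
        finally show "norm (f' (\<Xi> t z) (u t)) \<le> L * norm (u t)" .
        show "norm (a *\<^sub>R ?E p q) \<le> e / (2 * k) * norm (a *\<^sub>R (q - p))"
          by (rule E[OF pq(1,2)])
        show "norm (b *\<^sub>R ?E p' q') \<le> e / (2 * k) * norm (a *\<^sub>R (q - p))"
          unfolding ab by (rule E[OF pq(3,4)])
      qed
      also have "\<dots> = L * norm (u t) + e / k * norm (a *\<^sub>R (q - p))"
        by simp
      finally show "norm (u' t) \<le> L * norm (u t) + e / k * norm (a *\<^sub>R (q - p))" .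
    qed (use \<open>T \<ge> 0\<close> \<open>L \<ge> 0\<close> \<open>e > 0\<close> \<open>k > 0\<close> in auto)
    also have "u 0 = 0" using ab by (simp add: u_def)
    finally show ?thesis using \<open>k > 0\<close> by (simp add: u_def flip: k_def)
  qed
  with \<open>d > 0\<close> show "\<exists>d>0. \<forall>p\<in>ball z d. \<forall>q\<in>ball z d. \<forall>p'\<in>ball z d. \<forall>q'\<in>ball z d. \<forall>a b.
      a *\<^sub>R (q - p) = b *\<^sub>R (q' - p') \<longrightarrow>
      norm (a *\<^sub>R (\<Xi> T q - \<Xi> T p) - b *\<^sub>R (\<Xi> T q' - \<Xi> T p')) \<le> e * norm (a *\<^sub>R (q - p))"
    by blast
qed

text \<open>The hypothesis \<open>skew\<close> says that \<open>B\<close> is constant along pairs of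
  solutions of the linearized equation. For differences of true solutions it drifts by a quantity of
  second order in their size times \<open>e\<close>, which vanishes in the limit of difference
  quotients.\<close>

lemma flow_preserves_bilinear:
  fixes B :: "'a \<Rightarrow> 'a \<Rightarrow> real"
  assumes "T \<ge> 0" "bounded_bilinear B"
    and skew: "\<And>x u v. B (f' x u) v + B u (f' x v) = 0"
    and D: "has_strict_derivative (\<Xi> T) D z"
  shows "B (D v) (D w) = B v w"
proof -
  interpret B: bounded_bilinear B by fact
  obtain k where "k > 0" and k: "\<And>x y. norm (B x y) \<le> norm x * norm y * k"
    using B.pos_bounded by blast
  obtain d0 C where "d0 > 0" "C > 0"
    and C: "\<And>x y t. x \<in> ball z d0 \<Longrightarrow> y \<in> ball z d0 \<Longrightarrow> 0 \<le> t \<Longrightarrow> t \<le> T \<Longrightarrow>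
      norm (\<Xi> t y - \<Xi> t x) \<le> C * norm (y - x)"
    using flow_lipschitz by blast
  define X where "X v n = real (Suc n) *\<^sub>R (\<Xi> T (z + v /\<^sub>R real (Suc n)) - \<Xi> T z)" for v n
  have X: "X v \<longlonglongrightarrow> D v" for v
    unfolding X_def by (rule has_strict_derivative_imp_LIMSEQ[OF D])
  have "norm (B (D v) (D w) - B v w) \<le> e * (2 * C * k * exp T * (norm v * norm w))" if "e > 0" for e
  proof (rule tendsto_upperbound)
    show "(\<lambda>n. norm (B (X v n) (X w n) - B v w)) \<longlonglongrightarrow> norm (B (D v) (D w) - B v w)"
      by (intro tendsto_intros B.tendsto X)
    obtain d where "d > 0" and
      d: "\<And>x y t. x \<in> ball z d \<Longrightarrow> y \<in> ball z d \<Longrightarrow> 0 \<le> t \<Longrightarrow> t \<le> T \<Longrightarrow>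
        norm (f (\<Xi> t y) - f (\<Xi> t x) - f' (\<Xi> t z) (\<Xi> t y - \<Xi> t x)) \<le> e * norm (y - x)"
      using flow_linearization[OF \<open>e > 0\<close>] by blast
    show "\<forall>\<^sub>F n in sequentially. norm (B (X v n) (X w n) - B v w) \<le> e * (2 * C * k * exp T * (norm v * norm w))"
      using eventually_in_ball_Suc[OF \<open>d > 0\<close>, of z v] eventually_in_ball_Suc[OF \<open>d > 0\<close>, of z w]
        eventually_in_ball_Suc[OF \<open>d0 > 0\<close>, of z v] eventually_in_ball_Suc[OF \<open>d0 > 0\<close>, of z w]
    proof eventually_elim
      case (elim n)
      \<comment> \<open>The reciprocal of the step length: the two perturbations are
        \<open>v /\<^sub>R s\<close> and \<open>w /\<^sub>R s\<close>.\<close>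
      define s where "s = real (Suc n)"
      have "s > 0" by (simp add: s_def)
      define U where "U v t = \<Xi> t (z + v /\<^sub>R s) - \<Xi> t z" for v t
      define U' where "U' v t = f (\<Xi> t (z + v /\<^sub>R s)) - f (\<Xi> t z)" for v t
      have U': "((\<lambda>t. U v t) has_vector_derivative U' v t) (at t)" if "0 < t" for v t
        unfolding U_def U'_def using that by (intro derivative_intros flow_has_vector_derivative)
      have U_le: "norm (U v t) \<le> C * norm (v /\<^sub>R s)" "norm (U w t) \<le> C * norm (w /\<^sub>R s)"
        and E_le: "norm (U' v t - f' (\<Xi> t z) (U v t)) \<le> e * norm (v /\<^sub>R s)"
          "norm (U' w t - f' (\<Xi> t z) (U w t)) \<le> e * norm (w /\<^sub>R s)"
        if "0 < t" "t < T" for t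
        using C[of z "z + v /\<^sub>R s" t] C[of z "z + w /\<^sub>R s" t] d[of z "z + v /\<^sub>R s" t]
          d[of z "z + w /\<^sub>R s" t] that elim \<open>d > 0\<close> \<open>d0 > 0\<close>
        by (simp_all add: U_def U'_def s_def)
      let ?c = "2 * (e * C * k * (norm (v /\<^sub>R s) * norm (w /\<^sub>R s)))"
      have "norm (B (U v T) (U w T) - B (v /\<^sub>R s) (w /\<^sub>R s))
          \<le> (norm (B (U v 0) (U w 0) - B (v /\<^sub>R s) (w /\<^sub>R s)) + ?c) * exp ((0 + 1) * T)"
      \<comment> \<open>Gronwall with \<open>L = 0\<close>: the derivative is bounded by the
        constant \<open>?c\<close>, and the function starts at 0.\<close>
      proof (rule gronwall_norm)
        show "continuous_on {0..T} (\<lambda>t. B (U v t) (U w t) - B (v /\<^sub>R s) (w /\<^sub>R s))"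
          unfolding U_def by (intro continuous_intros B.continuous_on continuous_on_flow)
        fix t assume t: "0 < t" "t < T"
        have "((\<lambda>t. B (U v t) (U w t)) has_vector_derivative B (U v t) (U' w t) + B (U' v t) (U w t)) (at t)"
          using B.has_vector_derivative[OF U' U'] t by simp
        then show "((\<lambda>t. B (U v t) (U w t) - B (v /\<^sub>R s) (w /\<^sub>R s)) has_vector_derivative
            B (U v t) (U' w t) + B (U' v t) (U w t)) (at t)"
          by (auto intro!: derivative_eq_intros)
        let ?Ev = "U' v t - f' (\<Xi> t z) (U v t)" and ?Ew = "U' w t - f' (\<Xi> t z) (U w t)"
        \<comment> \<open>By \<open>skew\<close> the linear parts of the two derivatives cancel,
          leaving only the errors.\<close>
        have "B (U v t) (U' w t) + B (U' v t) (U w t) = B (U v t) ?Ew + B ?Ev (U w t)"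
          using skew[of "\<Xi> t z" "U v t" "U w t"] by (simp add: B.diff_left B.diff_right)
        also have "norm \<dots> \<le> norm (U v t) * norm ?Ew * k + norm ?Ev * norm (U w t) * k"
          by (intro order_trans[OF norm_triangle_ineq] add_mono k)
        also have "\<dots> \<le> (C * norm (v /\<^sub>R s)) * (e * norm (w /\<^sub>R s)) * k + (e * norm (v /\<^sub>R s)) * (C * norm (w /\<^sub>R s)) * k"
          using U_le[OF t] E_le[OF t] \<open>k > 0\<close> \<open>C > 0\<close> \<open>e > 0\<close>
          by (intro add_mono mult_mono) auto
        finally show "norm (B (U v t) (U' w t) + B (U' v t) (U w t))
            \<le> 0 * norm (B (U v t) (U w t) - B (v /\<^sub>R s) (w /\<^sub>R s)) + ?c"
          by (simp add: algebra_simps)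
      qed (use \<open>T \<ge> 0\<close> \<open>k > 0\<close> \<open>C > 0\<close> \<open>e > 0\<close> in auto)
      \<comment> \<open>One factor \<open>s\<close> for each argument of \<open>B\<close> turns the
        differences into difference quotients.\<close>
      then have "s * s * norm (B (U v T) (U w T) - B (v /\<^sub>R s) (w /\<^sub>R s)) \<le> s * s * (?c * exp T)"
        using \<open>s > 0\<close> by (intro mult_left_mono) (auto simp: U_def)
      also have "s * s * (?c * exp T) = e * (2 * C * k * exp T * (norm v * norm w))"
        using \<open>s > 0\<close> by (simp add: field_simps)
      also have "s * s * norm (B (U v T) (U w T) - B (v /\<^sub>R s) (w /\<^sub>R s)) =
          norm ((s * s) *\<^sub>R (B (U v T) (U w T) - B (v /\<^sub>R s) (w /\<^sub>R s)))"
        using \<open>s > 0\<close> by (simp add: abs_mult)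
      also have "(s * s) *\<^sub>R (B (U v T) (U w T) - B (v /\<^sub>R s) (w /\<^sub>R s)) =
          B (s *\<^sub>R U v T) (s *\<^sub>R U w T) - B (s *\<^sub>R v /\<^sub>R s) (s *\<^sub>R w /\<^sub>R s)"
        by (simp only: B.scaleR_left B.scaleR_right real_scaleR_def right_diff_distrib mult.assoc
            mult.left_commute)
      also have "\<dots> = B (X v n) (X w n) - B v w"
        using \<open>s > 0\<close> unfolding X_def U_def s_def[symmetric] by simp
      finally show ?case .
    qed
  qed simp
  then have "B (D v) (D w) - B v w = 0" by (rule norm_le_all_imp_0)
  then show ?thesis by simp
qed

end

section \<open>Gradients and the symmetry of the Hessian\<close>

text \<open>The second difference \<open>\<Delta> u v\<close> over a small parallelogram is
  symmetric in \<open>u\<close> and \<open>v\<close>, and it equals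
  \<open>s\<^sup>2 * (v \<bullet> S u)\<close> up to an error of order \<open>e * s\<^sup>2\<close>.
  Differentiability of the gradient at the single point \<open>x\<close> suffices.\<close>

lemma second_derivative_symmetric:
  fixes H :: "'a::real_inner \<Rightarrow> real"
  assumes grad: "\<And>y. GDERIV H y :> g y"
    and S: "(g has_derivative S) (at x)"
  shows "u \<bullet> S v = v \<bullet> S u"
proof -
  interpret S: bounded_linear S using S by (rule has_derivative_bounded_linear)
  have "norm (u \<bullet> S v - v \<bullet> S u) \<le> e * (2 * (norm u + norm v)\<^sup>2)" if "e > 0" for e
  proof -
    obtain d where "d > 0" and d: "\<And>y. norm (y - x) < d \<Longrightarrow> norm (g y - g x - S (y - x)) \<le> e * norm (y - x)"
      using S \<open>e > 0\<close> unfolding has_derivative_at_alt by blast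
    have pos: "norm u + norm v + 1 > 0" by (simp add: add_nonneg_pos)
    \<comment> \<open>Small enough that the whole parallelogram lies within distance
      \<open>d\<close> of \<open>x\<close>.\<close>
    define s where "s = d / (norm u + norm v + 1)"
    have "s > 0" using \<open>d > 0\<close> pos by (simp add: s_def)
    have "s * (norm u + norm v + 1) = d" using pos by (simp add: s_def)
    then have sd: "s * (norm u + norm v) < d" using \<open>s > 0\<close> by (simp add: algebra_simps)
    define \<Delta> where "\<Delta> u v = H (x + s *\<^sub>R u + s *\<^sub>R v) - H (x + s *\<^sub>R u) - H (x + s *\<^sub>R v) + H x" for u v
    have \<Delta>: "\<bar>\<Delta> u v - s\<^sup>2 * (v \<bullet> S u)\<bar> \<le> s\<^sup>2 * (2 * e * norm v * (norm u + norm v))"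
      if small: "s * (norm u + norm v) < d" for u v
    proof -
      \<comment> \<open>The difference of \<open>H\<close> on two parallel edges;
        \<open>\<Delta> u v\<close> is its increment from 0 to \<open>s\<close>, so the mean value
        theorem reduces it to gradients.\<close>
      define \<psi> where "\<psi> r = H (x + s *\<^sub>R u + r *\<^sub>R v) - H (x + r *\<^sub>R v)" for r
      have H: "((\<lambda>r. H (y + r *\<^sub>R v)) has_real_derivative v \<bullet> g (y + r *\<^sub>R v)) (at r)" for y r
      proof -
        have "((\<lambda>r. y + r *\<^sub>R v) has_derivative (\<lambda>h. h *\<^sub>R v)) (at r)"
          by (auto intro!: derivative_eq_intros)
        then have "((\<lambda>r. H (y + r *\<^sub>R v)) has_derivative (\<lambda>h. (h *\<^sub>R v) \<bullet> g (y + r *\<^sub>R v))) (at r)"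
          using grad[of "y + r *\<^sub>R v"] unfolding gderiv_def by (rule has_derivative_compose)
        then show ?thesis
          unfolding has_field_derivative_def by (rule has_derivative_eq_rhs) (simp add: fun_eq_iff)
      qed
      have "(\<psi> has_real_derivative v \<bullet> g (x + s *\<^sub>R u + r *\<^sub>R v) - v \<bullet> g (x + r *\<^sub>R v)) (at r)" for r
        unfolding \<psi>_def by (intro DERIV_diff H)
      from MVT2[OF \<open>s > 0\<close> this] obtain \<xi> where \<xi>: "0 < \<xi>" "\<xi> < s" and
        mvt: "\<psi> s - \<psi> 0 = (s - 0) * (v \<bullet> g (x + s *\<^sub>R u + \<xi> *\<^sub>R v) - v \<bullet> g (x + \<xi> *\<^sub>R v))"
        by blast
      let ?a = "s *\<^sub>R u + \<xi> *\<^sub>R v" and ?b = "\<xi> *\<^sub>R v"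
      have "norm ?a \<le> s * norm u + \<xi> * norm v"
        using \<open>s > 0\<close> \<xi> by (intro norm_triangle_le) auto
      also have "\<dots> \<le> s * (norm u + norm v)"
        using \<xi> by (simp add: distrib_left mult_right_mono)
      finally have a: "norm ?a \<le> s * (norm u + norm v)" .
      have "\<xi> * norm v \<le> s * (norm u + norm v)"
        using \<xi> by (intro mult_mono) auto
      then have b: "norm ?b \<le> s * (norm u + norm v)" using \<xi> by simp
      have E: "norm (g (x + y) - g x - S y) \<le> e * (s * (norm u + norm v))"
        if "norm y \<le> s * (norm u + norm v)" for y
      proof -
        have "norm (g (x + y) - g x - S y) \<le> e * norm y" using d[of "x + y"] that small by simp
        also have "\<dots> \<le> e * (s * (norm u + norm v))" using that \<open>e > 0\<close> by simp
        finally show ?thesis .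
      qed
      let ?Ea = "g (x + ?a) - g x - S ?a" and ?Eb = "g (x + ?b) - g x - S ?b"
      have "\<Delta> u v = s * (v \<bullet> (g (x + ?a) - g (x + ?b)))"
        using mvt by (simp add: \<Delta>_def \<psi>_def inner_diff_right add.assoc)
      \<comment> \<open>Both gradients are expanded at \<open>x\<close>. Since
        \<open>?a - ?b = s *\<^sub>R u\<close>, the unknown \<open>\<xi>\<close> drops out of the
        linear part.\<close>
      also have "g (x + ?a) - g (x + ?b) = s *\<^sub>R S u + (?Ea - ?Eb)"
        by (simp add: S.add S.scaleR)
      finally have "\<Delta> u v - s\<^sup>2 * (v \<bullet> S u) = s * (v \<bullet> (?Ea - ?Eb))"
        by (simp add: inner_add_right power2_eq_square algebra_simps)
      then have "\<bar>\<Delta> u v - s\<^sup>2 * (v \<bullet> S u)\<bar> = s * \<bar>v \<bullet> (?Ea - ?Eb)\<bar>"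
        using \<open>s > 0\<close> by (simp add: abs_mult)
      also have "\<dots> \<le> s * (norm v * (norm ?Ea + norm ?Eb))"
        using \<open>s > 0\<close> by (intro mult_left_mono order_trans[OF Cauchy_Schwarz_ineq2] norm_triangle_ineq4) auto
      also have "\<dots> \<le> s * (norm v * (e * (s * (norm u + norm v)) + e * (s * (norm u + norm v))))"
        using \<open>s > 0\<close> by (intro mult_left_mono add_mono E a b) auto
      also have "\<dots> = s\<^sup>2 * (2 * e * norm v * (norm u + norm v))"
        by (simp add: power2_eq_square algebra_simps)
      finally show ?thesis .
    qed
    have "\<Delta> u v = \<Delta> v u" by (simp add: \<Delta>_def algebra_simps)
    then have "\<bar>s\<^sup>2 * (u \<bullet> S v) - s\<^sup>2 * (v \<bullet> S u)\<bar>
        \<le> s\<^sup>2 * (2 * e * norm v * (norm u + norm v)) + s\<^sup>2 * (2 * e * norm u * (norm v + norm u))"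
      using \<Delta>[of u v] \<Delta>[of v u] sd by (simp add: add.commute)
    also have "\<dots> = s\<^sup>2 * (e * (2 * (norm u + norm v)\<^sup>2))"
      by (simp add: power2_eq_square algebra_simps)
    also have "\<bar>s\<^sup>2 * (u \<bullet> S v) - s\<^sup>2 * (v \<bullet> S u)\<bar> = s\<^sup>2 * norm (u \<bullet> S v - v \<bullet> S u)"
      by (simp add: abs_mult flip: right_diff_distrib)
    finally show ?thesis using \<open>s > 0\<close> by simp
  qed
  then have "u \<bullet> S v - v \<bullet> S u = 0" by (rule norm_le_all_imp_0)
  then show ?thesis by simp
qed

text \<open>The Riesz representative of the derivative \<open>D\<close> is
  \<open>adjoint D 1\<close>, so the description in \<open>grad\<close> denotes.\<close>

lemma GDERIV_grad:
  fixes f :: "'a::euclidean_space \<Rightarrow> real"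
  assumes "f differentiable (at x)"
  shows "GDERIV f x :> grad f x"
proof -
  obtain D where D: "(f has_derivative D) (at x)"
    using assms by (auto simp: differentiable_def)
  then have "D h = h \<bullet> adjoint D 1" for h
    using adjoint_works[OF has_derivative_linear[OF D], of h 1] by simp
  then have "GDERIV f x :> adjoint D 1"
    using D unfolding gderiv_def by (metis (no_types, lifting) ext)
  then show ?thesis
    by (simp add: GDERIV_imp_grad_eq)
qed

section \<open>Reversibility of flows whose field anticommutes with an involution\<close>

text \<open>The identity \<open>return\<close> makes \<open>R \<circ> \<Xi> t \<circ> R\<close> a
  two-sided inverse of \<open>\<Xi> t\<close>, which yields bijectivity and the form of the inverse
  together.\<close>

lemma flow_reversible:
  fixes f :: "'a::euclidean_space \<Rightarrow> 'a"
  assumes unique: "uniquely_globally_defined f"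
    and flow: "solution_operator f \<Xi>"
    and R: "linear_involution R"
    and anti: "\<And>z. f (R z) = - R (f z)"
    and "t \<ge> 0"
  shows "reversible_wrt R (\<Xi> t)"
proof -
  have "linear R" using R by (simp add: linear_involution_def)
  then have bl: "bounded_linear R" by (simp add: linear_conv_bounded_linear)
  have RR [simp]: "R (R z) = z" for z
    using R unfolding linear_involution_def by (metis comp_apply id_apply)
  have fs: "forward_solution f z (\<lambda>t. \<Xi> t z)" for z
    using flow by (simp add: solution_operator_def)
  have flow0 [simp]: "\<Xi> 0 z = z" for z
    using fs by (simp add: forward_solution_def)
  have der: "((\<lambda>t. \<Xi> t z) has_vector_derivative f (\<Xi> s z)) (at s within {0..})" if "s \<ge> 0" for s z
    using fs that by (simp add: forward_solution_def)
  have return: "\<Xi> t (R (\<Xi> t z)) = R z" for z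
  proof -
    \<comment> \<open>Both branches equal \<open>R z\<close> at \<open>s = t\<close>. The second one
      is there because uniqueness compares solutions on the whole half-line.\<close>
    define w where "w s = (if s \<in> {0..t} then R (\<Xi> (t - s) z) else \<Xi> (s - t) (R z))" for s
    have "forward_solution f (R (\<Xi> t z)) w"
      unfolding forward_solution_def
    proof (intro conjI allI impI)
      show "w 0 = R (\<Xi> t z)" using \<open>t \<ge> 0\<close> by (simp add: w_def)
      fix s :: real assume "s \<ge> 0"
      have "(w has_vector_derivative (if s \<in> {0..t} then f (R (\<Xi> (t - s) z)) else f (\<Xi> (s - t) (R z))))
          (at s within {0..})"
        unfolding w_def
      proof (rule has_vector_derivative_If_within_closures[where T = "{t..}"])
        show "s \<in> {0..t} \<union> {t..}" "{0..} = {0..t} \<union> {t..}"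
          using \<open>s \<ge> 0\<close> \<open>t \<ge> 0\<close> by auto
        \<comment> \<open>The closures meet in the single point \<open>t\<close>, which both pieces
          already contain.\<close>
        have un: "{0..t} \<union> closure {0..t} \<inter> closure {t..} = {0..t}" "{t..} \<union> closure {0..t} \<inter> closure {t..} = {t..}"
          using \<open>t \<ge> 0\<close> by auto
        show "((\<lambda>s. R (\<Xi> (t - s) z)) has_vector_derivative f (R (\<Xi> (t - s) z)))
            (at s within {0..t} \<union> closure {0..t} \<inter> closure {t..})"
          if "s \<in> {0..t} \<union> closure {0..t} \<inter> closure {t..}"
        proof -
          have s: "s \<in> {0..t}" using that unfolding un .
          have "((\<lambda>s. t - s) has_vector_derivative -1) (at s within {0..t})"
            by (auto intro!: derivative_eq_intros)
          moreover have "((\<lambda>t. \<Xi> t z) has_vector_derivative f (\<Xi> (t - s) z)) (at (t - s) within (\<lambda>s. t - s) ` {0..t})"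
            by (rule has_vector_derivative_within_subset[OF der]) (use s in auto)
          ultimately have "((\<lambda>t. \<Xi> t z) \<circ> (\<lambda>s. t - s) has_vector_derivative (-1) *\<^sub>R f (\<Xi> (t - s) z)) (at s within {0..t})"
            by (rule vector_diff_chain_within)
          from bounded_linear.has_vector_derivative[OF bl this]
          show ?thesis unfolding un by (simp add: o_def anti linear_neg[OF \<open>linear R\<close>])
        qed
        show "((\<lambda>s. \<Xi> (s - t) (R z)) has_vector_derivative f (\<Xi> (s - t) (R z)))
            (at s within {t..} \<union> closure {0..t} \<inter> closure {t..})"
          if "s \<in> {t..} \<union> closure {0..t} \<inter> closure {t..}"
        proof -
          have s: "s \<in> {t..}" using that unfolding un .
          have "((\<lambda>s. s - t) has_vector_derivative 1) (at s within {t..})"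
            by (auto intro!: derivative_eq_intros)
          moreover have "((\<lambda>t. \<Xi> t (R z)) has_vector_derivative f (\<Xi> (s - t) (R z))) (at (s - t) within (\<lambda>s. s - t) ` {t..})"
            by (rule has_vector_derivative_within_subset[OF der]) (use s in auto)
          ultimately have "((\<lambda>t. \<Xi> t (R z)) \<circ> (\<lambda>s. s - t) has_vector_derivative 1 *\<^sub>R f (\<Xi> (s - t) (R z))) (at s within {t..})"
            by (rule vector_diff_chain_within)
          then show ?thesis unfolding un by (simp add: o_def)
        qed
      qed (auto simp: \<open>t \<ge> 0\<close>)
      then show "(w has_vector_derivative f (w s)) (at s within {0..})"
        by (simp add: w_def if_distrib)
    qed
    with unique fs have "w t = \<Xi> t (R (\<Xi> t z))"
      using \<open>t \<ge> 0\<close> unfolding uniquely_globally_defined_def by blast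
    then show ?thesis using \<open>t \<ge> 0\<close> by (simp add: w_def)
  qed
  have "bij R" by (rule o_bij[of R]) (simp_all add: fun_eq_iff)
  have inv1: "(R \<circ> \<Xi> t \<circ> R) \<circ> \<Xi> t = id" and inv2: "\<Xi> t \<circ> (R \<circ> \<Xi> t \<circ> R) = id"
    using return by (simp_all add: fun_eq_iff)
  then have "bij (\<Xi> t)" by (rule o_bij)
  moreover have "inv (\<Xi> t) = R \<circ> \<Xi> t \<circ> R"
    using inv1 inv2 by (rule inv_unique_comp[rotated])
  ultimately show ?thesis
    unfolding reversible_wrt_def using \<open>linear R\<close> \<open>bij R\<close> by (simp add: fun_eq_iff)
qed

section \<open>Matrix algebra and symplecticity of the Hamiltonian flow\<close>

lemma
  assumes "invertible A"
  shows matrix_inv_right: "A ** matrix_inv A = mat 1"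
    and matrix_inv_left: "matrix_inv A ** A = mat 1"
  using someI_ex[OF assms[unfolded invertible_def]] by (simp_all add: matrix_inv_def)

lemma minus_matrix_vector_mult: "(- A) *v x = - (A *v x)" for A :: "'a::ring_1 ^ 'n ^ 'm"
  by (simp add: vec_eq_iff matrix_vector_mult_def sum_negf)

lemma minus_matrix_mult_left: "(- A) ** B = - (A ** B)" for A :: "'a::ring_1 ^ 'n ^ 'm"
  by (simp add: vec_eq_iff matrix_matrix_mult_def sum_negf)

lemma minus_matrix_mult_right: "A ** (- B) = - (A ** B)" for A :: "'a::ring_1 ^ 'n ^ 'm"
  by (simp add: vec_eq_iff matrix_matrix_mult_def sum_negf)

lemma continuous_on_Blinfun_matrix:
  assumes "continuous_on S (M :: 'a::topological_space \<Rightarrow> real ^ 'n ^ 'm)"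
  shows "continuous_on S (\<lambda>x. Blinfun ((*v) (M x)))"
proof -
  have bl: "bounded_linear ((*v) M)" for M :: "real ^ 'n ^ 'm"
    by (simp add: linear_conv_bounded_linear[symmetric])
  have "linear (\<lambda>M :: real ^ 'n ^ 'm. Blinfun ((*v) M))"
    by (rule linearI; rule blinfun_eqI)
      (simp_all add: bounded_linear_Blinfun_apply[OF bl] blinfun.bilinear_simps
        matrix_vector_mult_add_rdistrib scaleR_matrix_vector_assoc)
  then have "bounded_linear (\<lambda>M :: real ^ 'n ^ 'm. Blinfun ((*v) M))"
    by (simp add: linear_conv_bounded_linear)
  then show ?thesis using assms by (rule bounded_linear.continuous_on)
qed

text \<open>In the form \<open>B u v = u \<bullet> (J *v v)\<close> the matrix \<open>J\<close>
  cancels the inverse in the linearized field and leaves the Hessian. Antisymmetry of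
  \<open>J\<close> gives the two terms opposite signs, and symmetry of the Hessian makes them
  cancel, which is the hypothesis \<open>skew\<close> of the conservation lemma.\<close>

lemma hamiltonian_flow_symplectic:
  fixes J :: "real ^ 'm ^ 'm"
  assumes J: "transpose J = - J" "invertible J"
    and H: "C2_function H"
    and flow: "solution_operator (hamiltonian_field J H) \<Xi>"
    and "t \<ge> 0"
  shows "symplectic_wrt J (\<Xi> t)"
proof -
  define M where "M z = matrix_inv J ** jacobian (grad H) (at z)" for z
  have bl: "bounded_linear ((*v) A)" for A :: "real ^ 'm ^ 'm"
    by (simp add: linear_conv_bounded_linear[symmetric])
  define f' where "f' z = Blinfun ((*v) (M z))" for z
  have f': "blinfun_apply (f' z) = (*v) (M z)" for z
    unfolding f'_def by (rule bounded_linear_Blinfun_apply[OF bl])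
  have S: "(grad H has_derivative (*v) (jacobian (grad H) (at z))) (at z)" for z
    using H unfolding C2_function_def C1_map_def by (simp add: jacobian_works)
  interpret C1_flow "hamiltonian_field J H" f' \<Xi>
  proof
    show "(hamiltonian_field J H has_derivative blinfun_apply (f' x)) (at x)" for x
      using bounded_linear.has_derivative[OF bl[of "matrix_inv J"] S[of x]]
      by (simp add: f' M_def hamiltonian_field_def[abs_def] matrix_vector_mul_assoc)
    have "bounded_linear ((**) (matrix_inv J))"
      unfolding linear_conv_bounded_linear[symmetric]
      by (rule linearI) (simp only: matrix_add_ldistrib, simp only: matrix_scalar_ac scalar_matrix_assoc)
    moreover have "continuous_on UNIV (\<lambda>z. jacobian (grad H) (at z))"
      using H by (simp add: C2_function_def C1_map_def)
    ultimately have "continuous_on UNIV M"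
      unfolding M_def by (rule bounded_linear.continuous_on)
    then show "continuous_on UNIV f'"
      unfolding f'_def by (rule continuous_on_Blinfun_matrix)
  qed (fact flow)
  obtain D where D: "\<And>z. has_strict_derivative (\<Xi> t) (D z) z"
    using flow_has_strict_derivative[OF \<open>t \<ge> 0\<close>] by metis
  have jac: "jacobian (\<Xi> t) (at z) *v v = D z v" for z v
  proof -
    have "D z = frechet_derivative (\<Xi> t) (at z)"
      by (intro frechet_derivative_at has_strict_derivative_imp_has_derivative D)
    moreover have "linear (D z)" using D by (simp add: has_strict_derivative_def)
    ultimately show ?thesis by (simp add: jacobian_def matrix_works)
  qed
  have JJ: "J *v (matrix_inv J *v x) = x" for x
    using J(2) by (simp add: matrix_vector_mul_assoc matrix_inv_right)
  have tr: "x \<bullet> (A *v y) = (transpose A *v x) \<bullet> y" for x y and A :: "real ^ 'm ^ 'm"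
    by (simp add: dot_lmul_matrix)
  define B where "B u v = u \<bullet> (J *v v)" for u v
  have "bounded_bilinear B"
    unfolding B_def
    by (rule bounded_bilinear.comp[OF bounded_bilinear_inner bounded_linear_ident bl])
  moreover have "B (f' z u) v + B u (f' z v) = 0" for z u v
  proof -
    let ?S = "jacobian (grad H) (at z)"
    have "B (f' z u) v = (transpose J *v (f' z u)) \<bullet> v"
      unfolding B_def by (rule tr)
    also have "\<dots> = - (v \<bullet> (?S *v u))"
      unfolding J(1) by (simp add: f' M_def JJ inner_commute minus_matrix_vector_mult flip: matrix_vector_mul_assoc)
    finally have "B (f' z u) v = - (v \<bullet> (?S *v u))" .
    moreover have "B u (f' z v) = u \<bullet> (?S *v v)"
      by (simp add: B_def f' M_def JJ flip: matrix_vector_mul_assoc)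
    moreover have "u \<bullet> (?S *v v) = v \<bullet> (?S *v u)"
      using H by (intro second_derivative_symmetric[where H = H, OF GDERIV_grad S]) (simp add: C2_function_def)
    ultimately show ?thesis by simp
  qed
  ultimately have B: "B (D z v) (D z w) = B v w" for z v w
    using D by (intro flow_preserves_bilinear[OF \<open>t \<ge> 0\<close>])
  have "transpose (jacobian (\<Xi> t) (at z)) ** J ** jacobian (\<Xi> t) (at z) = J" (is "transpose ?D ** J ** ?D = J") for z
  proof -
    \<comment> \<open>A matrix is determined by its bilinear form, so conservation of
      \<open>B\<close> becomes the matrix identity.\<close>
    have "v \<bullet> ((transpose ?D ** J ** ?D) *v w) = v \<bullet> (J *v w)" for v w
    proof -
      have "v \<bullet> ((transpose ?D ** J ** ?D) *v w) = v \<bullet> (transpose ?D *v (J *v (?D *v w)))"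
        by (simp only: matrix_vector_mul_assoc matrix_mul_assoc)
      also have "\<dots> = (?D *v v) \<bullet> (J *v (?D *v w))"
        by (simp only: tr[of v] transpose_transpose)
      also have "\<dots> = v \<bullet> (J *v w)"
        using B by (simp add: jac B_def)
      finally show ?thesis .
    qed
    then show ?thesis by (metis matrix_eq vector_eq_ldot)
  qed
  then show ?thesis
    unfolding symplectic_wrt_def using J(2) C1_map_if_has_strict_derivative[OF D] by blast
qed

section \<open>Reversing symmetries of Hamiltonian fields and the momentum flip\<close>

text \<open>Differentiating the invariance of \<open>H\<close> expresses \<open>grad H z\<close> as
  the transpose of \<open>R\<close> applied to \<open>grad H (R z)\<close>; the matrix hypothesis
  then supplies the sign.\<close>

lemma hamiltonian_field_anticommute:
  fixes J :: "real ^ 'm ^ 'm"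
  assumes H: "\<And>z. H differentiable (at z)"
    and "linear R"
    and J: "matrix R ** matrix_inv J ** transpose (matrix R) = - matrix_inv J"
    and HR: "\<And>z. H (R z) = H z"
  shows "hamiltonian_field J H (R z) = - R (hamiltonian_field J H z)"
proof -
  have R: "R x = matrix R *v x" for x
    using \<open>linear R\<close> by (simp add: matrix_works)
  have "(R has_derivative R) (at z)"
    using \<open>linear R\<close> by (simp add: linear_imp_has_derivative)
  then have "((\<lambda>z. H (R z)) has_derivative (\<lambda>h. R h \<bullet> grad H (R z))) (at z)"
    using GDERIV_grad[OF H, of "R z"] unfolding gderiv_def by (rule has_derivative_compose)
  moreover have "R h \<bullet> y = h \<bullet> (transpose (matrix R) *v y)" for h y
  proof -
    have "R h \<bullet> y = y \<bullet> (matrix R *v h)"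
      using \<open>linear R\<close> by (simp add: matrix_works inner_commute)
    also have "\<dots> = h \<bullet> (transpose (matrix R) *v y)"
      by (simp add: dot_lmul_matrix[symmetric] inner_commute)
    finally show ?thesis .
  qed
  ultimately have "GDERIV H z :> transpose (matrix R) *v grad H (R z)"
    unfolding gderiv_def HR by simp
  then have "grad H z = transpose (matrix R) *v grad H (R z)"
    by (rule GDERIV_imp_grad_eq)
  then have "R (hamiltonian_field J H z) =
      matrix R *v (matrix_inv J *v (transpose (matrix R) *v grad H (R z)))"
    using R[of "hamiltonian_field J H z"] by (simp only: hamiltonian_field_def)
  also have "\<dots> = (matrix R ** matrix_inv J ** transpose (matrix R)) *v grad H (R z)"
    by (simp only: matrix_vector_mul_assoc matrix_mul_assoc)
  finally have "R (hamiltonian_field J H z) =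
      (matrix R ** matrix_inv J ** transpose (matrix R)) *v grad H (R z)" .
  then show ?thesis
    unfolding J hamiltonian_field_def by (simp add: minus_matrix_vector_mult)
qed

lemma transpose_matrix_momentum_flip: "transpose (matrix momentum_flip) = matrix momentum_flip"
  by (auto simp: vec_eq_iff transpose_def matrix_def momentum_flip_def phase_point_def
      position_def velocity_def axis_def split: sum.split)

text \<open>An off-diagonal block matrix exchanges positions and velocities and hence anticommutes
  with the flip. This passes to the inverse without computing its blocks.\<close>

lemma momentum_flip_conjugates_inverse:
  fixes A :: "real ^ 'n ^ 'n"
  assumes J: "J = block_matrix 0 (- A) (transpose A) 0" "invertible J"
  shows "matrix momentum_flip ** matrix_inv J ** transpose (matrix momentum_flip) = - matrix_inv J"
proof -
  let ?M = "matrix momentum_flip :: real ^ ('n + 'n) ^ ('n + 'n)"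
  have M: "?M *v z = momentum_flip z" for z
    by (simp add: matrix_works linear_momentum_flip)
  have MM: "?M ** ?M = mat 1"
    using momentum_flip_involution unfolding matrix_eq
    by (simp add: M fun_eq_iff flip: matrix_vector_mul_assoc)
  have "J *v momentum_flip z = - momentum_flip (J *v z)" for z
  proof -
    have "J *v momentum_flip (phase_point q v) = - momentum_flip (J *v phase_point q v)" for q v
      unfolding J(1)
      by (simp add: block_matrix_mult_phase_point minus_matrix_vector_mult
          linear_neg[OF matrix_vector_mul_linear])
         (simp add: phase_point_def vec_eq_iff split: sum.split)
    then show ?thesis by (metis phase_point_position_velocity)
  qed
  then have JM: "J ** ?M = - (?M ** J)"
    unfolding matrix_eq by (simp add: M minus_matrix_vector_mult flip: matrix_vector_mul_assoc)
  \<comment> \<open>The claim is first proved after multiplication by \<open>J\<close> on the left,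
    where anticommutation applies; \<open>J\<close> is cancelled afterwards.\<close>
  have "J ** (?M ** matrix_inv J ** ?M) = (J ** ?M) ** matrix_inv J ** ?M"
    by (simp only: matrix_mul_assoc)
  also have "\<dots> = - (?M ** (J ** matrix_inv J) ** ?M)"
    by (simp only: JM minus_matrix_mult_left matrix_mul_assoc)
  also have "\<dots> = J ** - matrix_inv J"
    using J(2) by (simp add: matrix_inv_right MM minus_matrix_mult_right)
  finally have "matrix_inv J ** (J ** (?M ** matrix_inv J ** ?M)) = matrix_inv J ** (J ** - matrix_inv J)"
    by simp
  then show ?thesis
    using J(2) by (simp add: matrix_mul_assoc matrix_inv_left transpose_matrix_momentum_flip)
qed

theorem proposition4p9:
  fixes J :: "real ^ ('n::finite + 'n) ^ ('n + 'n)"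
    and H :: "real ^ ('n + 'n) \<Rightarrow> real"
    and \<Xi> :: "real \<Rightarrow> real ^ ('n + 'n) \<Rightarrow> real ^ ('n + 'n)"
  assumes "transpose J = - J"
    and "invertible J"
    and "C2_function H"
    and "uniquely_globally_defined (hamiltonian_field J H)"
    and "solution_operator (hamiltonian_field J H) \<Xi>"
  shows "(\<forall>t\<ge>0. symplectic_wrt J (\<Xi> t)) \<and>
    (\<forall>R :: real ^ ('n + 'n) \<Rightarrow> real ^ ('n + 'n).
      linear_involution R \<and>
      matrix R ** matrix_inv J ** transpose (matrix R) = - matrix_inv J \<and>
      (\<forall>z. H (R z) = H z)
      \<longrightarrow> (\<forall>t\<ge>0. reversible_wrt R (\<Xi> t))) \<and>
    (\<forall>A :: real ^ 'n ^ 'n.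
      invertible A \<and>
      J = block_matrix 0 (- A) (transpose A) 0 \<and>
      (\<forall>q v. H (phase_point q v) = H (phase_point q (- v)))
      \<longrightarrow> (\<forall>t\<ge>0. reversible_wrt momentum_flip (\<Xi> t)))"
proof -
  \<comment> \<open>The second claim is kept general in \<open>R\<close>, so that the third reduces
    to checking its hypotheses for the flip.\<close>
  have reversible: "reversible_wrt R (\<Xi> t)"
    if "linear_involution R" "matrix R ** matrix_inv J ** transpose (matrix R) = - matrix_inv J"
      "\<And>z. H (R z) = H z" "t \<ge> 0" for R t
    using that assms
    by (intro flow_reversible[of "hamiltonian_field J H"] hamiltonian_field_anticommute)
      (auto simp: C2_function_def linear_involution_def)
  have "reversible_wrt momentum_flip (\<Xi> t)"
    if J: "J = block_matrix 0 (- A) (transpose A) 0"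
      and even: "\<And>q v. H (phase_point q v) = H (phase_point q (- v))" and "t \<ge> 0"
    for A :: "real ^ 'n ^ 'n" and t
  proof (rule reversible)
    show "linear_involution (momentum_flip :: real ^ ('n + 'n) \<Rightarrow> _)"
      by (simp add: linear_involution_def linear_momentum_flip momentum_flip_involution)
    show "matrix momentum_flip ** matrix_inv J ** transpose (matrix momentum_flip) = - matrix_inv J"
      using J assms(2) by (rule momentum_flip_conjugates_inverse)
    show "H (momentum_flip z) = H z" for z
      by (metis even momentum_flip_def phase_point_position_velocity)
  qed fact
  with reversible hamiltonian_flow_symplectic[OF assms(1,2,3,5)] show ?thesis
    by blast
qed

end
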